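(* Let $L:\Sigma\setminus\Gamma\to\Sigma$, $L(x,y)=(\alpha(x),\beta(x,y))$, be a Lorenz map satisfying the following three conditions: (1) $\left|\frac{\partial\beta}{\partial x}(x,y)\right|<\frac{3}{4\sqrt2}$ and $\left|\frac{\partial\beta}{\partial y}(x,y)\right|<\frac{3}{4\sqrt2}$ for any $(x,y)\in\Sigma\setminus\Gamma$; (2) $0.8<\alpha^2(1)<\alpha(1)<1$, where $\alpha^2=\alpha\circ\alpha$; (3) $\alpha'(x)<2$ for any $x$ with $0.8<x\le 1$. Then $L$ admits a one-parameter family $\{L_\mu\}_{\mu\in I}$ of Lorenz maps, with $I=[0,\mu_0]$ for some $\mu_0<1$, given by $$L_\mu(x,y)=L(x,y)-(\mu x,0),$$ such that for any $\varepsilon>0$ there exist $\delta>0$ and $\mu\in I$ with $\mu>0$ for which the following (i) and (ii) hold. (i) For any infinite $\delta$-pseudo-orbit $\{\mathbf{x}_n\}_{n=0}^\infty$ of $L_\mu$ (possibly with $\mathbf{x}_n\in\Gamma$ for some $n$), there exists $\mathbf{z}\in\Sigma$ with $\bigcup_{n=0}^\infty\{L^n(\mathbf{z})\}\cap\Gamma=\emptyset$ and $|L^n(\mathbf{z})-\mathbf{x}_n|\le\varepsilon$ for all $n\ge 0$. (ii) For any finite $\delta$-pseudo-orbit $\{\mathbf{x}_n\}_{n=0}^m$ of $L_\mu$ with $\mathbf{x}_m\in\Gamma$, there exists $\mathbf{z}\in\Sigma$ with $\bigcup_{n=0}^{m-1}\{L^n(\mathbf{z})\}\cap\Gamma=\emptyset$,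 $L^m(\mathbf{z})\in\Gamma$ and $|L^n(\mathbf{z})-\mathbf{x}_n|\le\varepsilon$ for all $0\le n\le m$.
   Context: Let $\Sigma=\{(x,y)\in\mathbb{R}^2: |x|,|y|\le 1\}$ and $\Gamma=\{(0,y): |y|\le 1\}$. Let $\Sigma_+$ and $\Sigma_-$ denote the components of $\Sigma\setminus\Gamma$ containing $(1,0)$ and $(-1,0)$ respectively. Lorenz map: a map $L:\Sigma\setminus\Gamma\to\Sigma$ is a Lorenz map if it is a piecewise $C^1$ diffeomorphism (i.e. a $C^1$ diffeomorphism onto its image on each of $\Sigma_\pm$) of the form $L(x,y)=(\alpha(x),\beta(x,y))$, where: - $\alpha:[-1,1]\setminus\{0\}\to[-1,1]$ is a piecewise $C^1$ map ($C^1$ on each of $[-1,0)$ and $(0,1]$) with $\alpha(-x)=-\alpha(x)$, $\lim_{x\to0+}\alpha(x)=-1$, $\alpha(1)<1$, $\lim_{x\to0+}\alpha'(x)=\infty$, and $\alpha'(x)>\sqrt2$ for any $x\in(0,1]$; - $\beta:\Sigma\setminus\Gamma\to[-1,1]$ is a contraction in the $y$-direction; - the images $L(\Sigma_+)$ and $L(\Sigma_-)$ are mutually disjoint cusps in $\Sigma$ whose vertices $\mathbf{v}_+$, $\mathbf{v}_-$ satisfy $\mathbf{v}_+\in\{-1\}\times[-1,1]$ and $\mathbf{v}_-\in\{1\}\times[-1,1]$; here the vertex $\mathbf{v}_\pm$ is the point to which $L(x,y)$ converges (uniformly in $y$) as $x\to0\pm$. Pseudo-orbit: for $\delta>0$,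 a sequence $\{\mathbf{x}_n\}_{n\ge0}\subset\Sigma$ (finite or infinite) is a $\delta$-pseudo-orbit of a Lorenz map $L$ if $|L(\mathbf{x}_n)-\mathbf{x}_{n+1}|\le\delta$ for every $n\ge 0$ (such that $\mathbf{x}_{n+1}$ is a term of the sequence); when $\mathbf{x}_n\in\Gamma$, where $L$ is undefined, this condition is replaced by the requirement that $\mathbf{x}_{n+1}$ be contained in the $\delta$-neighborhood of $\mathbf{v}_+$ or in the $\delta$-neighborhood of $\mathbf{v}_-$, with $\mathbf{v}_\pm$ the vertices for the map under consideration. *)

theory Defs
  imports "HOL-Analysis.Analysis"
begin

definition \<Sigma> :: "(real \<times> real) set" where
  "\<Sigma> = {(x, y). \<bar>x\<bar> \<le> 1 \<and> \<bar>y\<bar> \<le> 1}"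

definition \<Gamma> :: "(real \<times> real) set" where
  "\<Gamma> = {(x, y). x = 0 \<and> \<bar>y\<bar> \<le> 1}"

definition \<Sigma>_pos :: "(real \<times> real) set" where
  "\<Sigma>_pos = connected_component_set (\<Sigma> - \<Gamma>) (1, 0)"

definition \<Sigma>_neg :: "(real \<times> real) set" where
  "\<Sigma>_neg = connected_component_set (\<Sigma> - \<Gamma>) (-1, 0)"

lemma \<Sigma>_pos_eq: "\<Sigma>_pos = {0<..1} \<times> {-1..1}"
proof
  have c: "convex ({0<..1} \<times> {-1..1} :: (real \<times> real) set)"
    by (intro convex_Times) auto
  show "{0<..1} \<times> {-1..1} \<subseteq> \<Sigma>_pos"
    unfolding \<Sigma>_pos_def
    by (rule connected_component_maximal)
      (use convex_connected[OF c] in \<open>auto simp: \<Sigma>_def \<Gamma>_def\<close>)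
  show "\<Sigma>_pos \<subseteq> {0<..1} \<times> {-1..1}"
  proof
    fix p assume p: "p \<in> \<Sigma>_pos"
    have sub: "\<Sigma>_pos \<subseteq> \<Sigma> - \<Gamma>" "connected \<Sigma>_pos"
      by (simp_all add: \<Sigma>_pos_def connected_component_subset)
    have one: "(1, 0) \<in> \<Sigma>_pos"
      by (auto simp: \<Sigma>_pos_def connected_component_refl_eq \<Sigma>_def \<Gamma>_def)
    have con: "connected (fst ` \<Sigma>_pos)"
      by (intro connected_continuous_image sub continuous_intros)
    have "0 \<notin> fst ` \<Sigma>_pos"
      using sub by (auto simp: \<Sigma>_def \<Gamma>_def)
    moreover have "fst p \<in> fst ` \<Sigma>_pos" "1 \<in> fst ` \<Sigma>_pos"
      using p one by force+
    ultimately have "fst p > 0"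
      using connectedD_interval[OF con, of "fst p" 1 0] by (meson linorder_not_le zero_le_one)
    moreover have "p \<in> \<Sigma>"
      using p sub by blast
    ultimately show "p \<in> {0<..1} \<times> {-1..1}"
      by (cases p) (auto simp: \<Sigma>_def abs_le_iff)
  qed
qed

lemma \<Sigma>_neg_eq: "\<Sigma>_neg = {-1..<0} \<times> {-1..1}"
proof
  have c: "convex ({-1..<0} \<times> {-1..1} :: (real \<times> real) set)"
    by (intro convex_Times) auto
  show "{-1..<0} \<times> {-1..1} \<subseteq> \<Sigma>_neg"
    unfolding \<Sigma>_neg_def
    by (rule connected_component_maximal)
      (use convex_connected[OF c] in \<open>auto simp: \<Sigma>_def \<Gamma>_def\<close>)
  show "\<Sigma>_neg \<subseteq> {-1..<0} \<times> {-1..1}"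
  proof
    fix p assume p: "p \<in> \<Sigma>_neg"
    have sub: "\<Sigma>_neg \<subseteq> \<Sigma> - \<Gamma>" "connected \<Sigma>_neg"
      by (simp_all add: \<Sigma>_neg_def connected_component_subset)
    have one: "(-1, 0) \<in> \<Sigma>_neg"
      by (auto simp: \<Sigma>_neg_def connected_component_refl_eq \<Sigma>_def \<Gamma>_def)
    have con: "connected (fst ` \<Sigma>_neg)"
      by (intro connected_continuous_image sub continuous_intros)
    have "0 \<notin> fst ` \<Sigma>_neg"
      using sub by (auto simp: \<Sigma>_def \<Gamma>_def)
    moreover have "fst p \<in> fst ` \<Sigma>_neg" "-1 \<in> fst ` \<Sigma>_neg"
      using p one by force+
    ultimately have "fst p < 0"
      using connectedD_interval[OF con, of "-1" "fst p" 0]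
      by (metis linorder_not_le neg_le_0_iff_le zero_le_one)
    moreover have "p \<in> \<Sigma>"
      using p sub by blast
    ultimately show "p \<in> {-1..<0} \<times> {-1..1}"
      by (cases p) (auto simp: \<Sigma>_def abs_le_iff)
  qed
qed

text \<open>
  The sets of interest are not open, so differentiability is taken within the set
  (one-sided at boundary points).
\<close>

definition C1_on ::
    "('a::real_normed_vector \<Rightarrow> 'b::real_normed_vector) \<Rightarrow> 'a set \<Rightarrow> bool" where
  "C1_on f S \<longleftrightarrow>
     (\<exists>f'. (\<forall>p\<in>S. (f has_derivative blinfun_apply (f' p)) (at p within S)) \<and>
           continuous_on S f')"

definition C1_diffeo_on ::
    "('a::real_normed_vector \<Rightarrow> 'b::real_normed_vector) \<Rightarrow> 'a set \<Rightarrow> bool" where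
  "C1_diffeo_on f S \<longleftrightarrow> inj_on f S \<and> C1_on f S \<and> C1_on (inv_into S f) (f ` S)"

text \<open>
  The derivative of \<open>\<alpha>\<close> on \<open>(0,1]\<close> (one-sided at \<open>1\<close>), and the partial derivatives of
  \<open>\<beta>\<close> on \<open>\<Sigma> - \<Gamma>\<close> (one-sided on the boundary of the square).
\<close>

definition alpha_deriv :: "(real \<Rightarrow> real) \<Rightarrow> real \<Rightarrow> real" where
  "alpha_deriv \<alpha> x = vector_derivative \<alpha> (at x within {0<..1})"

definition beta_dx :: "(real \<Rightarrow> real \<Rightarrow> real) \<Rightarrow> real \<Rightarrow> real \<Rightarrow> real" where
  "beta_dx \<beta> x y = vector_derivative (\<lambda>s. \<beta> s y) (at x within {-1..1} - {0})"

definition beta_dy :: "(real \<Rightarrow> real \<Rightarrow> real) \<Rightarrow> real \<Rightarrow> real \<Rightarrow> real" where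
  "beta_dy \<beta> x y = vector_derivative (\<lambda>t. \<beta> x t) (at y within {-1..1})"

text \<open>
  \<open>v\<close> is the vertex of the cusp \<open>L ` \<Sigma>_pos\<close> (resp. \<open>L ` \<Sigma>_neg\<close>): \<open>L (x, y)\<close> tends to \<open>v\<close>
  uniformly in \<open>y\<close> as \<open>x\<close> tends to \<open>0\<close> from the right (resp. left). Such a \<open>v\<close> is unique.
\<close>

definition vertex_pos :: "(real \<times> real \<Rightarrow> real \<times> real) \<Rightarrow> real \<times> real \<Rightarrow> bool" where
  "vertex_pos L v \<longleftrightarrow> uniform_limit {-1..1} (\<lambda>x y. L (x, y)) (\<lambda>y. v) (at_right 0)"

definition vertex_neg :: "(real \<times> real \<Rightarrow> real \<times> real) \<Rightarrow> real \<times> real \<Rightarrow> bool" where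
  "vertex_neg L v \<longleftrightarrow> uniform_limit {-1..1} (\<lambda>x y. L (x, y)) (\<lambda>y. v) (at_left 0)"

definition lorenz_base :: "(real \<Rightarrow> real) \<Rightarrow> bool" where
  "lorenz_base \<alpha> \<longleftrightarrow>
     \<alpha> \<in> {-1..1} - {0} \<rightarrow> {-1..1} \<and>
     C1_on \<alpha> {-1..<0} \<and> C1_on \<alpha> {0<..1} \<and>
     (\<forall>x\<in>{-1..1} - {0}. \<alpha> (- x) = - \<alpha> x) \<and>
     (\<alpha> \<longlongrightarrow> -1) (at_right 0) \<and>
     \<alpha> 1 < 1 \<and>
     filterlim (alpha_deriv \<alpha>) at_top (at_right 0) \<and>
     (\<forall>x\<in>{0<..1}. alpha_deriv \<alpha> x > sqrt 2)"

definition y_contraction :: "(real \<Rightarrow> real \<Rightarrow> real) \<Rightarrow> bool" where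
  "y_contraction \<beta> \<longleftrightarrow>
     (\<exists>c<1. \<forall>x y y'. (x, y) \<in> \<Sigma> - \<Gamma> \<longrightarrow> (x, y') \<in> \<Sigma> - \<Gamma> \<longrightarrow>
        \<bar>\<beta> x y - \<beta> x y'\<bar> \<le> c * \<bar>y - y'\<bar>)"

text \<open>
  A partial map on \<open>\<Sigma> - \<Gamma>\<close> is represented by a total function; its values outside
  \<open>\<Sigma> - \<Gamma>\<close> are irrelevant.
\<close>

definition lorenz_map_with ::
    "(real \<times> real \<Rightarrow> real \<times> real) \<Rightarrow> (real \<Rightarrow> real) \<Rightarrow> (real \<Rightarrow> real \<Rightarrow> real) \<Rightarrow> bool" where
  "lorenz_map_with L \<alpha> \<beta> \<longleftrightarrow>
     L \<in> \<Sigma> - \<Gamma> \<rightarrow> \<Sigma> \<and>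
     C1_diffeo_on L \<Sigma>_pos \<and> C1_diffeo_on L \<Sigma>_neg \<and>
     (\<forall>x y. (x, y) \<in> \<Sigma> - \<Gamma> \<longrightarrow> L (x, y) = (\<alpha> x, \<beta> x y)) \<and>
     lorenz_base \<alpha> \<and>
     (\<forall>x y. (x, y) \<in> \<Sigma> - \<Gamma> \<longrightarrow> \<beta> x y \<in> {-1..1}) \<and>
     y_contraction \<beta> \<and>
     L ` \<Sigma>_pos \<inter> L ` \<Sigma>_neg = {} \<and>
     (\<exists>v\<in>{-1} \<times> {-1..1}. vertex_pos L v) \<and>
     (\<exists>v\<in>{1} \<times> {-1..1}. vertex_neg L v)"

definition lorenz_map :: "(real \<times> real \<Rightarrow> real \<times> real) \<Rightarrow> bool" where
  "lorenz_map L \<longleftrightarrow> (\<exists>\<alpha> \<beta>. lorenz_map_with L \<alpha> \<beta>)"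

definition shifted :: "(real \<times> real \<Rightarrow> real \<times> real) \<Rightarrow> real \<Rightarrow> real \<times> real \<Rightarrow> real \<times> real" where
  "shifted L \<mu> = (\<lambda>(x, y). L (x, y) - (\<mu> * x, 0))"

definition pseudo_step ::
    "real \<Rightarrow> (real \<times> real \<Rightarrow> real \<times> real) \<Rightarrow> real \<times> real \<Rightarrow> real \<times> real \<Rightarrow> bool" where
  "pseudo_step \<delta> L p q \<longleftrightarrow>
     (if p \<in> \<Gamma> then \<exists>v. (vertex_pos L v \<or> vertex_neg L v) \<and> q \<in> ball v \<delta>
      else norm (L p - q) \<le> \<delta>)"

definition infinite_pseudo_orbit ::
    "real \<Rightarrow> (real \<times> real \<Rightarrow> real \<times> real) \<Rightarrow> (nat \<Rightarrow> real \<times> real) \<Rightarrow> bool" where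
  "infinite_pseudo_orbit \<delta> L X \<longleftrightarrow>
     (\<forall>n. X n \<in> \<Sigma>) \<and> (\<forall>n. pseudo_step \<delta> L (X n) (X (Suc n)))"

text \<open>Only the terms \<open>X 0, \<dots>, X m\<close> are constrained.\<close>

definition finite_pseudo_orbit ::
    "real \<Rightarrow> (real \<times> real \<Rightarrow> real \<times> real) \<Rightarrow> nat \<Rightarrow> (nat \<Rightarrow> real \<times> real) \<Rightarrow> bool" where
  "finite_pseudo_orbit \<delta> L m X \<longleftrightarrow>
     (\<forall>n\<le>m. X n \<in> \<Sigma>) \<and> (\<forall>n<m. pseudo_step \<delta> L (X n) (X (Suc n)))"

end

theory Submission
  imports Defs
begin

text \<open>
  On the base interval \<open>\<alpha>\<close> expands by more than \<open>sqrt 2\<close>, so a pseudo-orbit is shadowed by pulling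
  back nested intervals around its points. The obstruction is the discontinuity: an interval around
  a point near \<open>0\<close> must be cut at \<open>0\<close>, its image then ends at \<open>-1\<close> or \<open>1\<close>, and from there
  on this end point follows the critical orbit. A pseudo-orbit of \<open>L\<close> itself could
  step beyond the critical orbit and be driven away by the expansion.

  A pseudo-orbit of the shifted map cannot do this. As \<open>\<alpha> x - \<mu> * x\<close> is smaller than \<open>\<alpha> x\<close> in
  modulus near the ends of the interval, the shift pushes it into the interval. While the
  end point runs through \<open>1\<close>, \<open>\<alpha> 1\<close>, \<open>\<alpha> (\<alpha> 1)\<close>, all above \<open>0.8\<close>, the pseudo-orbit near it gains almost
  \<open>0.8 * \<mu>\<close> at each step. After three steps its distance from the end point exceeds
  \<open>\<mu> / (sqrt 2 - 1)\<close>, and from then on expansion outweighs the loss of at most \<open>\<mu>\<close> per step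
  that the shift may cause elsewhere. This bookkeeping is the invariant \<open>room\<close>;
  \<open>room_outer\<close> and \<open>room_inner\<close> show that it survives a step. The two ends of an interval are treated independently, and \<open>room_nonempty\<close> shows that they never
  cross. Thus \<open>trap_step\<close> gives compact intervals off \<open>0\<close>, each of whose images covers the next
  interval, and \<open>covering_compact_orbit\<close> and \<open>pull_back_point\<close> give the infinite and finite shadows.
  Each interval with \<open>x = 0\<close> contains \<open>0\<close>, so a finite pseudo-orbit ending on \<open>\<Gamma>\<close> has a shadow
  ending on \<open>\<Gamma>\<close>.

  The shadow of the first coordinates runs on the same side of \<open>\<Gamma>\<close> as the pseudo-orbit. The partial
  derivatives of \<open>\<beta>\<close> are less than \<open>3 / (4 * sqrt 2)\<close>, so a base error \<open>e\<close> and a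
  fibre error \<open>2 * e\<close> lead to a fibre error of at most \<open>2 * e\<close> again (\<open>lift_line_shadow\<close>).

  The shifted maps are Lorenz maps for small \<open>\<mu>\<close> because \<open>\<alpha>'\<close> is bounded away from \<open>sqrt 2\<close>, the
  images of the two sides are a positive distance apart where they might meet, and the inverse
  branches factor through those of \<open>L\<close> (\<open>lorenz_map_shifted\<close>).
\<close>

section \<open>Maps of class C1\<close>

lemma C1_on_cong:
  assumes "C1_on f S" and "\<And>x. x \<in> S \<Longrightarrow> f x = g x"
  shows "C1_on g S"
proof -
  obtain f' where f': "\<And>p. p \<in> S \<Longrightarrow> (f has_derivative blinfun_apply (f' p)) (at p within S)"
    and cf': "continuous_on S f'"
    using assms(1) unfolding C1_on_def by blast
  have "(g has_derivative blinfun_apply (f' p)) (at p within S)" if p: "p \<in> S" for p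
    by (rule has_derivative_transform[OF p _ f'[OF p]]) (simp add: assms(2))
  with cf' show ?thesis unfolding C1_on_def by (intro exI conjI ballI)
qed

lemma C1_on_imp_continuous_on:
  assumes "C1_on f S"
  shows "continuous_on S f"
proof -
  obtain f' where "\<And>p. p \<in> S \<Longrightarrow> (f has_derivative blinfun_apply (f' p)) (at p within S)"
    using assms unfolding C1_on_def by blast
  then show ?thesis
    unfolding continuous_on_eq_continuous_within by (intro ballI has_derivative_continuous)
qed

lemma C1_on_compose:
  assumes "C1_on f S" and "C1_on g T" and "f ` S \<subseteq> T"
  shows "C1_on (\<lambda>x. g (f x)) S"
proof -
  obtain f' where f': "\<And>p. p \<in> S \<Longrightarrow> (f has_derivative blinfun_apply (f' p)) (at p within S)"
    and cf': "continuous_on S f'"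
    using assms(1) unfolding C1_on_def by blast
  obtain g' where g': "\<And>p. p \<in> T \<Longrightarrow> (g has_derivative blinfun_apply (g' p)) (at p within T)"
    and cg': "continuous_on T g'"
    using assms(2) unfolding C1_on_def by blast
  have cf: "continuous_on S f"
    using assms(1) by (rule C1_on_imp_continuous_on)
  show ?thesis
    unfolding C1_on_def
  proof (intro exI conjI ballI)
    fix p assume p: "p \<in> S"
    have "(g has_derivative blinfun_apply (g' (f p))) (at (f p) within f ` S)"
      using g' p assms(3) by (blast intro: has_derivative_subset)
    from has_derivative_in_compose[OF f'[OF p] this]
    show "((\<lambda>x. g (f x)) has_derivative blinfun_apply (g' (f p) o\<^sub>L f' p)) (at p within S)"
      by (simp add: blinfun_compose.rep_eq o_def)
  next
    have "continuous_on S (\<lambda>p. g' (f p))"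
      by (rule continuous_on_compose2[OF cg' cf assms(3)])
    then show "continuous_on S (\<lambda>p. g' (f p) o\<^sub>L f' p)"
      using cf' by (rule bounded_bilinear.continuous_on[OF bounded_bilinear_blinfun_compose])
  qed
qed

lemma C1_on_bounded_linear:
  assumes "bounded_linear h"
  shows "C1_on h S"
  unfolding C1_on_def
  by (rule exI[of _ "\<lambda>_. Blinfun h"])
    (simp add: bounded_linear_Blinfun_apply[OF assms] bounded_linear_imp_has_derivative[OF assms])

lemma C1_on_add:
  assumes "C1_on f S" and "C1_on g S"
  shows "C1_on (\<lambda>x. f x + g x) S"
proof -
  obtain f' where f': "\<And>p. p \<in> S \<Longrightarrow> (f has_derivative blinfun_apply (f' p)) (at p within S)"
    and cf': "continuous_on S f'"
    using assms(1) unfolding C1_on_def by blast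
  obtain g' where g': "\<And>p. p \<in> S \<Longrightarrow> (g has_derivative blinfun_apply (g' p)) (at p within S)"
    and cg': "continuous_on S g'"
    using assms(2) unfolding C1_on_def by blast
  show ?thesis
    unfolding C1_on_def
  proof (intro exI conjI ballI)
    fix p assume p: "p \<in> S"
    show "((\<lambda>x. f x + g x) has_derivative blinfun_apply (f' p + g' p)) (at p within S)"
      using has_derivative_add[OF f'[OF p] g'[OF p]] by (simp add: plus_blinfun.rep_eq)
  qed (intro continuous_on_add cf' cg')
qed

lemma C1_on_Pair:
  assumes "C1_on f S" and "C1_on g S"
  shows "C1_on (\<lambda>x. (f x, g x)) S"
proof -
  have "C1_on (\<lambda>x. (f x, 0) + (0, g x)) S"
    by (intro C1_on_add C1_on_compose[OF assms(1) C1_on_bounded_linear subset_UNIV]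
        C1_on_compose[OF assms(2) C1_on_bounded_linear subset_UNIV]
        bounded_linear_Pair bounded_linear_ident bounded_linear_zero)
  then show ?thesis by simp
qed

lemma C1_on_real_iff:
  fixes f :: "real \<Rightarrow> real"
  shows "C1_on f S \<longleftrightarrow>
    (\<exists>d. (\<forall>x\<in>S. (f has_real_derivative d x) (at x within S)) \<and> continuous_on S d)"
proof
  assume "C1_on f S"
  then obtain f' where f': "\<And>p. p \<in> S \<Longrightarrow> (f has_derivative blinfun_apply (f' p)) (at p within S)"
    and cf': "continuous_on S f'"
    unfolding C1_on_def by blast
  have eq: "blinfun_apply (f' p) = (*) (blinfun_apply (f' p) 1)" for p
  proof
    fix h :: real
    show "blinfun_apply (f' p) h = blinfun_apply (f' p) 1 * h"
      using blinfun.scaleR_right[of "f' p" h 1] by (simp add: mult.commute)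
  qed
  have "(f has_real_derivative blinfun_apply (f' p) 1) (at p within S)" if "p \<in> S" for p
    using f'[OF that] eq[of p] by (simp add: has_field_derivative_def)
  moreover have "continuous_on S (\<lambda>p. blinfun_apply (f' p) 1)"
    using cf' by (intro continuous_intros)
  ultimately show "\<exists>d. (\<forall>x\<in>S. (f has_real_derivative d x) (at x within S)) \<and> continuous_on S d"
    by (intro exI conjI ballI)
next
  assume "\<exists>d. (\<forall>x\<in>S. (f has_real_derivative d x) (at x within S)) \<and> continuous_on S d"
  then obtain d where d: "\<And>x. x \<in> S \<Longrightarrow> (f has_real_derivative d x) (at x within S)"
    and cd: "continuous_on S d"
    by blast
  show "C1_on f S"
    unfolding C1_on_def
  proof (intro exI conjI ballI)
    fix x assume x: "x \<in> S"
    have "blinfun_apply (blinfun_scaleR_right (d x)) = (*) (d x)"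
      by (simp add: fun_eq_iff)
    then show "(f has_derivative blinfun_apply (blinfun_scaleR_right (d x))) (at x within S)"
      using d[OF x] by (simp add: has_field_derivative_def)
  next
    show "continuous_on S (\<lambda>x. blinfun_scaleR_right (d x))"
      by (intro continuous_intros cd)
  qed
qed

text \<open>
  No openness of \<open>S\<close> is assumed, so the inverse function theorem is replaced by two consequences
  of expansion: the inverse is Lipschitz, hence continuous, and the derivative has absolute value at
  least \<open>c\<close>. The difference quotients of the inverse are then the reciprocals of those of \<open>f\<close>.
\<close>

lemma C1_on_inv_into_expanding:
  fixes f :: "real \<Rightarrow> real"
  assumes "C1_on f S" and "c > 0"
    and expand: "\<And>x y. x \<in> S \<Longrightarrow> y \<in> S \<Longrightarrow> c * \<bar>x - y\<bar> \<le> \<bar>f x - f y\<bar>"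
    and limpt: "\<And>x. x \<in> S \<Longrightarrow> at x within S \<noteq> bot"
  shows "C1_on (inv_into S f) (f ` S)"
proof -
  obtain d where d: "\<And>x. x \<in> S \<Longrightarrow> (f has_real_derivative d x) (at x within S)"
    and cd: "continuous_on S d"
    using assms(1) unfolding C1_on_real_iff by blast
  have inj: "inj_on f S"
    by (rule inj_onI) (use expand \<open>c > 0\<close> in \<open>fastforce simp: mult_le_0_iff\<close>)
  define g where "g = inv_into S f"
  have gf: "g (f x) = x" if "x \<in> S" for x
    using that inj by (simp add: g_def)
  have lip: "\<bar>g u - g v\<bar> \<le> \<bar>u - v\<bar> / c" if "u \<in> f ` S" "v \<in> f ` S" for u v
    using that expand \<open>c > 0\<close> by (auto simp: gf field_simps)
  have cont_g: "continuous_on (f ` S) g"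
  proof (rule continuous_on_iff[THEN iffD2], intro ballI allI impI)
    fix u and e :: real assume "u \<in> f ` S" "0 < e"
    then show "\<exists>\<delta>>0. \<forall>v\<in>f ` S. dist v u < \<delta> \<longrightarrow> dist (g v) (g u) < e"
      using lip \<open>c > 0\<close>
      by (intro exI[of _ "c * e"]) (fastforce simp: dist_real_def field_simps dest: le_less_trans)
  qed
  have d_lower: "c \<le> \<bar>d x\<bar>" if x: "x \<in> S" for x
  proof (rule tendsto_lowerbound)
    show "((\<lambda>y. \<bar>(f y - f x) / (y - x)\<bar>) \<longlongrightarrow> \<bar>d x\<bar>) (at x within S)"
      using d[OF x] by (intro tendsto_rabs) (simp add: has_field_derivative_iff)
    show "\<forall>\<^sub>F y in at x within S. c \<le> \<bar>(f y - f x) / (y - x)\<bar>"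
      using expand x by (auto simp: eventually_at_filter field_simps intro!: always_eventually)
  qed (use limpt x in auto)
  have "(g has_real_derivative inverse (d (g u))) (at u within f ` S)" if u: "u \<in> f ` S" for u
  proof -
    obtain x where x: "x \<in> S" "u = f x" using u by auto
    have "filterlim g (at x within S) (at u within f ` S)"
      unfolding filterlim_at
    proof
      show "\<forall>\<^sub>F v in at u within f ` S. g v \<in> S \<and> g v \<noteq> x"
        using x gf by (auto simp: eventually_at_filter intro!: always_eventually)
      show "(g \<longlongrightarrow> x) (at u within f ` S)"
        using cont_g u x gf unfolding continuous_on_def by auto
    qed
    then have "((\<lambda>v. inverse ((f (g v) - f x) / (g v - x))) \<longlongrightarrow> inverse (d x)) (at u within f ` S)"
      using d[OF x(1)] d_lower[OF x(1)] \<open>c > 0\<close>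
      by (intro tendsto_inverse)
        (auto simp: has_field_derivative_iff intro: filterlim_compose[where g = "\<lambda>y. (f y - f x) / (y - x)"])
    then have "((\<lambda>v. (g v - g u) / (v - u)) \<longlongrightarrow> inverse (d x)) (at u within f ` S)"
      by (rule Lim_transform_eventually) (use x gf in \<open>auto simp: eventually_at_filter intro!: always_eventually\<close>)
    then show ?thesis
      using x gf by (simp add: has_field_derivative_iff)
  qed
  moreover have "continuous_on (f ` S) (\<lambda>u. inverse (d (g u)))"
    using d_lower \<open>c > 0\<close> gf
    by (intro continuous_on_inverse continuous_on_compose2[OF cd cont_g]) force+
  ultimately show ?thesis
    unfolding C1_on_real_iff g_def by (intro exI conjI ballI)
qed

text \<open>
  The inverse of a skew product over \<open>\<gamma>\<close> is obtained from that of the skew product \<open>L\<close> over \<open>\<alpha>\<close>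
  with the same fibre maps: \<open>M (x, y) = (u, w)\<close> holds iff \<open>x = \<gamma>\<inverse> u\<close> and \<open>L (x, y) = (\<alpha> x, w)\<close>. So
  \<open>M\<inverse>\<close> is \<open>L\<inverse>\<close> after \<open>(u, w) \<mapsto> (\<alpha> (\<gamma>\<inverse> u), w)\<close>, and only a one-dimensional inverse has to be
  shown to be C1.
\<close>

lemma C1_diffeo_on_change_base:
  fixes \<alpha> \<gamma> :: "real \<Rightarrow> real" and \<beta> :: "real \<Rightarrow> real \<Rightarrow> real"
  assumes L: "C1_diffeo_on L (S \<times> T)"
    and L_eq: "\<And>x y. x \<in> S \<Longrightarrow> y \<in> T \<Longrightarrow> L (x, y) = (\<alpha> x, \<beta> x y)"
    and M_eq: "\<And>x y. x \<in> S \<Longrightarrow> y \<in> T \<Longrightarrow> M (x, y) = (\<gamma> x, \<beta> x y)"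
    and \<alpha>: "C1_on \<alpha> S" and \<gamma>: "C1_on \<gamma> S" and "c > 0"
    and expand: "\<And>x y. x \<in> S \<Longrightarrow> y \<in> S \<Longrightarrow> c * \<bar>x - y\<bar> \<le> \<bar>\<gamma> x - \<gamma> y\<bar>"
    and limpt: "\<And>x. x \<in> S \<Longrightarrow> at x within S \<noteq> bot"
  shows "C1_diffeo_on M (S \<times> T)"
proof -
  have injL: "inj_on L (S \<times> T)" and L1: "C1_on L (S \<times> T)"
    and L2: "C1_on (inv_into (S \<times> T) L) (L ` (S \<times> T))"
    using L unfolding C1_diffeo_on_def by simp_all
  have inj\<gamma>: "inj_on \<gamma> S"
  proof (rule inj_onI)
    fix x y assume "x \<in> S" "y \<in> S" "\<gamma> x = \<gamma> y"
    then have "c * \<bar>x - y\<bar> \<le> 0" using expand by fastforce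
    then show "x = y" using \<open>c > 0\<close> by (simp add: mult_le_0_iff)
  qed
  have injM: "inj_on M (S \<times> T)"
  proof (rule inj_onI)
    fix p q assume *: "p \<in> S \<times> T" "q \<in> S \<times> T" "M p = M q"
    obtain x y x' y' where [simp]: "p = (x, y)" "q = (x', y')" by (cases p, cases q)
    have "x = x'" using * M_eq inj\<gamma> by (auto dest: inj_onD)
    then have "L p = L q" using * L_eq M_eq by auto
    then show "p = q" using * injL by (blast dest: inj_onD)
  qed
  have fst1: "C1_on fst W" and snd1: "C1_on snd W" for W :: "(real \<times> real) set"
    by (auto intro: C1_on_bounded_linear bounded_linear_fst bounded_linear_snd)
  have M1: "C1_on M (S \<times> T)"
  proof (rule C1_on_cong)
    show "C1_on (\<lambda>p. (\<gamma> (fst p), snd (L p))) (S \<times> T)"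
      by (intro C1_on_Pair C1_on_compose[OF fst1 \<gamma>] C1_on_compose[OF L1 snd1, of UNIV]) auto
  qed (auto simp: L_eq M_eq)
  \<comment> \<open>the change of base coordinate: L after the inverse of M\<close>
  define \<phi> where "\<phi> = (\<lambda>q. (\<alpha> (inv_into S \<gamma> (fst q)), snd q :: real))"
  have \<phi>M: "\<phi> (M p) = L p" if "p \<in> S \<times> T" for p
    using that inj\<gamma> by (auto simp: \<phi>_def L_eq M_eq)
  have "C1_on (\<lambda>q. inv_into (S \<times> T) L (\<phi> q)) (M ` (S \<times> T))"
  proof (rule C1_on_compose[OF _ L2])
    have "C1_on (\<lambda>q. \<alpha> (inv_into S \<gamma> (fst q))) (M ` (S \<times> T))"
      by (rule C1_on_compose[where g = \<alpha>, OF _ \<alpha>],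
          rule C1_on_compose[OF fst1 C1_on_inv_into_expanding[OF \<gamma> \<open>c > 0\<close> expand limpt]])
        (auto simp: M_eq inj\<gamma>)
    then show "C1_on \<phi> (M ` (S \<times> T))"
      unfolding \<phi>_def by (intro C1_on_Pair snd1)
  qed (auto simp: \<phi>M)
  then have "C1_on (inv_into (S \<times> T) M) (M ` (S \<times> T))"
    by (rule C1_on_cong) (use injL injM \<phi>M in auto)
  with injM M1 show ?thesis by (simp add: C1_diffeo_on_def)
qed

section \<open>Lorenz maps and their shifts\<close>

lemma at_within_interval_neq_bot:
  "x \<in> {0<..1} \<Longrightarrow> at x within {0<..1} \<noteq> bot"
  "x \<in> {-1..<0} \<Longrightarrow> at x within {-1..<0} \<noteq> bot" for x :: real
proof -
  have "x islimpt S" if "x \<in> S" "convex S" "u \<in> S" "v \<in> S" "u \<noteq> v" for S and u v :: real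
    using connected_imp_perfect[OF convex_connected[OF that(2)] that(1)] that(3-5) by blast
  from this[of "{0<..1}" 1 "1/2"] this[of "{-1..<0}" "-1" "-1/2"]
  show "x \<in> {0<..1} \<Longrightarrow> at x within {0<..1} \<noteq> bot"
    and "x \<in> {-1..<0} \<Longrightarrow> at x within {-1..<0} \<noteq> bot"
    by (simp_all add: trivial_limit_within)
qed

text \<open>
  The derivative is taken within \<open>S\<close>, because the branches of a Lorenz map are differentiable only
  from one side at the end points of their domains.
\<close>

lemma mvt_lower:
  fixes f :: "real \<Rightarrow> real"
  assumes "x \<le> y" and "{x..y} \<subseteq> S"
    and "\<And>t. t \<in> {x..y} \<Longrightarrow> (f has_real_derivative d t) (at t within S)"
    and "\<And>t. t \<in> {x..y} \<Longrightarrow> m \<le> d t"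
  shows "m * (y - x) \<le> f y - f x"
proof -
  have "(f has_derivative (*) (d t)) (at t within {x..y})" if "x \<le> t" "t \<le> y" for t
    using assms(3)[of t] that assms(2)
    by (auto simp: has_field_derivative_def intro: has_derivative_subset)
  from mvt_very_simple[OF assms(1) this]
  obtain t where "t \<in> {x..y}" "f y - f x = d t * (y - x)" by auto
  with assms(1,4) show ?thesis by (simp add: mult_right_mono)
qed

lemma mvt_upper:
  fixes f :: "real \<Rightarrow> real"
  assumes "x \<le> y" and "{x..y} \<subseteq> S"
    and "\<And>t. t \<in> {x..y} \<Longrightarrow> (f has_real_derivative d t) (at t within S)"
    and "\<And>t. t \<in> {x..y} \<Longrightarrow> d t \<le> M"
  shows "f y - f x \<le> M * (y - x)"
proof -
  have "- M * (y - x) \<le> - f y - - f x"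
    by (rule mvt_lower[OF assms(1,2), of _ "\<lambda>t. - d t"]) (use assms(3,4) in \<open>auto intro: DERIV_minus\<close>)
  then show ?thesis by simp
qed

lemma alpha_deriv_eqI:
  assumes "x \<in> {0<..1}" and "(f has_real_derivative d) (at x within {0<..1})"
  shows "alpha_deriv f x = d"
  unfolding alpha_deriv_def
  by (rule vector_derivative_within[OF at_within_interval_neq_bot(1)[OF assms(1)]])
    (use assms(2) in \<open>simp add: has_real_derivative_iff_has_vector_derivative\<close>)

lemma alpha_deriv_works:
  assumes "C1_on f {0<..1}"
  shows "x \<in> {0<..1} \<Longrightarrow> (f has_real_derivative alpha_deriv f x) (at x within {0<..1})"
    and "continuous_on {0<..1} (alpha_deriv f)"
proof -
  obtain d where d: "\<And>x. x \<in> {0<..1} \<Longrightarrow> (f has_real_derivative d x) (at x within {0<..1})"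
    and cd: "continuous_on {0<..1} d"
    using assms unfolding C1_on_real_iff by blast
  have eq: "alpha_deriv f x = d x" if "x \<in> {0<..1}" for x
    using alpha_deriv_eqI d that by blast
  show "x \<in> {0<..1} \<Longrightarrow> (f has_real_derivative alpha_deriv f x) (at x within {0<..1})"
    using d eq by simp
  show "continuous_on {0<..1} (alpha_deriv f)"
    by (rule continuous_on_eq[OF cd]) (simp add: eq)
qed

lemma lorenz_baseD:
  assumes "lorenz_base \<alpha>"
  shows "x \<in> {-1..1} - {0} \<Longrightarrow> \<alpha> x \<in> {-1..1}"
    and "C1_on \<alpha> {-1..<0}" and "C1_on \<alpha> {0<..1}"
    and "x \<in> {-1..1} - {0} \<Longrightarrow> \<alpha> (- x) = - \<alpha> x"
    and "(\<alpha> \<longlongrightarrow> -1) (at_right 0)" and "\<alpha> 1 < 1"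
    and "filterlim (alpha_deriv \<alpha>) at_top (at_right 0)"
    and "x \<in> {0<..1} \<Longrightarrow> alpha_deriv \<alpha> x > sqrt 2"
  using assms by (auto simp: lorenz_base_def Pi_iff)

lemma lorenz_base_expand_right:
  assumes "lorenz_base \<alpha>" and "0 < x" "x \<le> y" "y \<le> 1"
  shows "sqrt 2 * (y - x) \<le> \<alpha> y - \<alpha> x"
  by (rule mvt_lower[of _ _ "{0<..1}", OF _ _ alpha_deriv_works(1)])
    (use assms lorenz_baseD[OF assms(1)] in \<open>auto intro: less_imp_le\<close>)

lemma lorenz_base_expand_left:
  assumes "lorenz_base \<alpha>" and "-1 \<le> x" "x \<le> y" "y < 0"
  shows "sqrt 2 * (y - x) \<le> \<alpha> y - \<alpha> x"
  using lorenz_base_expand_right[OF assms(1), of "-y" "-x"] assms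
    lorenz_baseD(4)[OF assms(1), of x] lorenz_baseD(4)[OF assms(1), of y]
  by (simp add: algebra_simps)

text \<open>
  Expansion from the limit value \<open>-1\<close> at \<open>0+\<close>. This replaces \<open>\<alpha> 0\<close>, which has no meaning, when a
  point of the pseudo-orbit lies on the discontinuity.
\<close>

lemma lorenz_base_lower:
  assumes "lorenz_base \<alpha>" and "0 < x" "x \<le> 1"
  shows "-1 + sqrt 2 * x \<le> \<alpha> x"
proof (rule tendsto_upperbound)
  show "((\<lambda>t. \<alpha> t + sqrt 2 * (x - t)) \<longlongrightarrow> -1 + sqrt 2 * x) (at_right 0)"
    using lorenz_baseD(5)[OF assms(1)] by (auto intro!: tendsto_eq_intros)
  have "\<forall>\<^sub>F t in at_right 0. t \<in> {0<..<x}"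
    using assms(2) eventually_at_right_real by blast
  then show "\<forall>\<^sub>F t in at_right 0. \<alpha> t + sqrt 2 * (x - t) \<le> \<alpha> x"
    by eventually_elim (use lorenz_base_expand_right[OF assms(1), of _ x] assms in fastforce)
qed simp

lemma lorenz_base_limit_left:
  assumes "lorenz_base \<alpha>"
  shows "(\<alpha> \<longlongrightarrow> 1) (at_left 0)"
proof -
  have "((\<lambda>x. - \<alpha> (- x)) \<longlongrightarrow> - (- 1)) (at_left 0)"
    using tendsto_minus[OF lorenz_baseD(5)[OF assms]]
    unfolding filterlim_at_left_to_right by simp
  moreover have "\<forall>\<^sub>F x in at_left 0. x \<in> {-1<..<(0::real)}"
    by (rule eventually_at_left_real) simp
  then have "\<forall>\<^sub>F x in at_left 0. - \<alpha> (- x) = \<alpha> x"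
    by eventually_elim (use lorenz_baseD(4)[OF assms] in force)
  ultimately show ?thesis
    by (simp add: tendsto_cong)
qed

text \<open>
  The derivative is large near \<open>0\<close> and attains its minimum on the remaining compact interval. The
  gap above \<open>sqrt 2\<close> is what the shift by \<open>\<mu>\<close> may consume.
\<close>

lemma alpha_deriv_uniform_gap:
  assumes "lorenz_base \<alpha>"
  obtains m where "m > sqrt 2" and "\<And>x. x \<in> {0<..1} \<Longrightarrow> m \<le> alpha_deriv \<alpha> x"
proof -
  note D = lorenz_baseD[OF assms]
  have "\<forall>\<^sub>F x in at_right 0. 2 \<le> alpha_deriv \<alpha> x"
    using D(7) by (simp add: filterlim_at_top)
  then obtain b where b: "b > 0" "\<And>x. 0 < x \<Longrightarrow> x < b \<Longrightarrow> 2 \<le> alpha_deriv \<alpha> x"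
    unfolding eventually_at_right_field by blast
  define c where "c = min b 1"
  have "continuous_on {c..1} (alpha_deriv \<alpha>)"
    by (rule continuous_on_subset[OF alpha_deriv_works(2)[OF D(3)]]) (use b in \<open>auto simp: c_def\<close>)
  then obtain x0 where x0: "x0 \<in> {c..1}" "\<And>x. x \<in> {c..1} \<Longrightarrow> alpha_deriv \<alpha> x0 \<le> alpha_deriv \<alpha> x"
    using continuous_attains_inf[of "{c..1}" "alpha_deriv \<alpha>"] by (auto simp: c_def)
  show ?thesis
  proof
    show "sqrt 2 < min 2 (alpha_deriv \<alpha> x0)"
      using D(8)[of x0] x0(1) b(1) by (auto simp: c_def sqrt2_less_2)
    show "min 2 (alpha_deriv \<alpha> x0) \<le> alpha_deriv \<alpha> x" if "x \<in> {0<..1}" for x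
      using that b(2)[of x] x0(2)[of x] by (cases "x < c") (auto simp: c_def min_le_iff_disj)
  qed
qed

lemma sqrt_2_bounds: "1.414 < sqrt 2" "sqrt 2 < 1.415"
  by (rule real_less_rsqrt, simp add: power2_eq_square)
    (rule real_less_lsqrt, simp_all add: power2_eq_square)

lemma C1_on_shift_base:
  fixes \<alpha> :: "real \<Rightarrow> real"
  assumes "C1_on \<alpha> S"
  shows "C1_on (\<lambda>x. \<alpha> x - \<mu> * x) S"
proof -
  have "C1_on (\<lambda>x. - \<mu> * x) S"
    by (intro C1_on_bounded_linear bounded_linear_mult_right)
  from C1_on_add[OF assms this] show ?thesis by simp
qed

lemma lorenz_base_shift:
  assumes "lorenz_base \<alpha>" and m: "m > sqrt 2" "\<And>x. x \<in> {0<..1} \<Longrightarrow> m \<le> alpha_deriv \<alpha> x"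
    and \<mu>: "0 \<le> \<mu>" "\<mu> < m - sqrt 2" "\<mu> < 1"
  shows "lorenz_base (\<lambda>x. \<alpha> x - \<mu> * x)"
proof -
  note D = lorenz_baseD[OF assms(1)]
  define \<gamma> where "\<gamma> = (\<lambda>x. \<alpha> x - \<mu> * x)"
  have odd: "\<gamma> (- x) = - \<gamma> x" if "x \<in> {-1..1} - {0}" for x
    using D(4)[OF that] by (simp add: \<gamma>_def)
  have pos: "\<gamma> x \<in> {-1..1}" if "x \<in> {0<..1}" for x
  proof -
    have "\<mu> * x \<le> sqrt 2 * x"
      using that \<mu> sqrt_2_bounds by (intro mult_right_mono) auto
    moreover have "-1 + sqrt 2 * x \<le> \<alpha> x"
      using lorenz_base_lower[OF assms(1), of x] that by simp
    ultimately have "-1 \<le> \<gamma> x" unfolding \<gamma>_def by linarith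
    moreover have "\<gamma> x \<le> 1"
      using D(1)[of x] that \<mu> by (simp add: \<gamma>_def mult_nonneg_nonneg add_increasing2 diff_le_eq)
    ultimately show ?thesis by simp
  qed
  have deriv: "alpha_deriv \<gamma> x = alpha_deriv \<alpha> x - \<mu>" if "x \<in> {0<..1}" for x
    unfolding \<gamma>_def
    by (rule alpha_deriv_eqI[OF that])
      (auto intro!: derivative_eq_intros alpha_deriv_works(1)[OF D(3) that])
  show ?thesis
    unfolding lorenz_base_def \<gamma>_def[symmetric]
  proof (intro conjI ballI)
    show "\<gamma> \<in> {-1..1} - {0} \<rightarrow> {-1..1}"
    proof
      fix x :: real assume x: "x \<in> {-1..1} - {0}"
      show "\<gamma> x \<in> {-1..1}"
        using pos[of x] pos[of "- x"] odd[OF x] x by (cases "x > 0") auto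
    qed
    show "C1_on \<gamma> {-1..<0}" "C1_on \<gamma> {0<..1}"
      unfolding \<gamma>_def using D by (auto intro: C1_on_shift_base)
    show "\<gamma> (- x) = - \<gamma> x" if "x \<in> {-1..1} - {0}" for x
      using odd that by blast
    show "(\<gamma> \<longlongrightarrow> -1) (at_right 0)"
      unfolding \<gamma>_def using D(5) by (auto intro!: tendsto_eq_intros)
    show "\<gamma> 1 < 1" using D(6) \<mu> by (simp add: \<gamma>_def)
    show "alpha_deriv \<gamma> x > sqrt 2" if "x \<in> {0<..1}" for x
      using deriv[OF that] m(2)[OF that] \<mu> by simp
    have "filterlim (\<lambda>x. - \<mu> + alpha_deriv \<alpha> x) at_top (at_right 0)"
      by (intro filterlim_tendsto_add_at_top[OF tendsto_const] D)
    moreover have "\<forall>\<^sub>F x in at_right 0. - \<mu> + alpha_deriv \<alpha> x = alpha_deriv \<gamma> x"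
      using eventually_at_right_real[of 0 1] by (auto elim!: eventually_mono simp: deriv)
    ultimately show "filterlim (alpha_deriv \<gamma>) at_top (at_right 0)"
      by (rule filterlim_mono_eventually[OF _ order_refl order_refl])
  qed
qed


lemma lorenz_map_withD:
  assumes "lorenz_map_with L \<alpha> \<beta>"
  shows "p \<in> \<Sigma> - \<Gamma> \<Longrightarrow> L p \<in> \<Sigma>"
    and "C1_diffeo_on L ({0<..1} \<times> {-1..1})" and "C1_diffeo_on L ({-1..<0} \<times> {-1..1})"
    and "x \<in> {-1..1} - {0} \<Longrightarrow> y \<in> {-1..1} \<Longrightarrow> L (x, y) = (\<alpha> x, \<beta> x y)"
    and "lorenz_base \<alpha>"
    and "x \<in> {-1..1} - {0} \<Longrightarrow> y \<in> {-1..1} \<Longrightarrow> \<beta> x y \<in> {-1..1}"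
    and "y_contraction \<beta>"
    and "L ` ({0<..1} \<times> {-1..1}) \<inter> L ` ({-1..<0} \<times> {-1..1}) = {}"
    and "\<exists>v\<in>{-1} \<times> {-1..1}. vertex_pos L v" and "\<exists>v\<in>{1} \<times> {-1..1}. vertex_neg L v"
proof -
  have *: "(x, y) \<in> \<Sigma> - \<Gamma>" if "x \<in> {-1..1} - {0}" "y \<in> {-1..1}" for x y
    using that by (auto simp: \<Sigma>_def \<Gamma>_def)
  show "p \<in> \<Sigma> - \<Gamma> \<Longrightarrow> L p \<in> \<Sigma>"
    using assms by (auto simp: lorenz_map_with_def)
  have "\<forall>x y. (x, y) \<in> \<Sigma> - \<Gamma> \<longrightarrow> L (x, y) = (\<alpha> x, \<beta> x y)"
    and "\<forall>x y. (x, y) \<in> \<Sigma> - \<Gamma> \<longrightarrow> \<beta> x y \<in> {-1..1}"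
    using assms by (simp_all add: lorenz_map_with_def)
  then show "x \<in> {-1..1} - {0} \<Longrightarrow> y \<in> {-1..1} \<Longrightarrow> L (x, y) = (\<alpha> x, \<beta> x y)"
    and "x \<in> {-1..1} - {0} \<Longrightarrow> y \<in> {-1..1} \<Longrightarrow> \<beta> x y \<in> {-1..1}"
    using * by simp_all
qed (use assms in \<open>simp_all add: lorenz_map_with_def \<Sigma>_pos_eq \<Sigma>_neg_eq\<close>)

text \<open>
  Points of the two sides can only collide under the shifted map if the shifted base map sends their
  first coordinates to the same point; since \<open>\<alpha> 1 < 1\<close>, this keeps them at a fixed distance from \<open>\<Gamma>\<close>. On the
  corresponding compact pieces the images under \<open>L\<close> are disjoint, hence a positive distance apart,
  while the shift moves every point by at most \<open>\<mu>\<close>.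
\<close>

lemma cusp_images_separated:
  assumes "lorenz_map_with L \<alpha> \<beta>"
  obtains r where "r > 0"
    and "\<And>\<mu> p q. 0 \<le> \<mu> \<Longrightarrow> \<mu> < r \<Longrightarrow> p \<in> {0<..1} \<times> {-1..1} \<Longrightarrow> q \<in> {-1..<0} \<times> {-1..1} \<Longrightarrow>
      shifted L \<mu> p \<noteq> shifted L \<mu> q"
proof -
  note D = lorenz_map_withD[OF assms]
  note B = lorenz_baseD[OF D(5)]
  have "\<forall>\<^sub>F x in at_right 0. \<alpha> x < - \<alpha> 1"
    using B(6) by (intro order_tendstoD(2)[OF B(5)]) simp
  then obtain b where b: "b > 0" "\<And>x. 0 < x \<Longrightarrow> x < b \<Longrightarrow> \<alpha> x < - \<alpha> 1"
    unfolding eventually_at_right_field by blast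
  define c where "c = min b 1"
  have c: "0 < c" "c \<le> 1" using b by (auto simp: c_def)
  define P where "P = L ` ({c..1} \<times> {-1..1})"
  define Q where "Q = L ` ({-1..-c} \<times> {-1..1})"
  have "continuous_on ({0<..1} \<times> {-1..1}) L" "continuous_on ({-1..<0} \<times> {-1..1}) L"
    using D(2,3) by (auto simp: C1_diffeo_on_def intro: C1_on_imp_continuous_on)
  moreover have "{c..1} \<times> {-1..1} \<subseteq> {0<..1} \<times> {-1..1::real}"
    "{-1..-c} \<times> {-1..1} \<subseteq> {-1..<0} \<times> {-1..1::real}"
    using c by auto
  ultimately have "continuous_on ({c..1} \<times> {-1..1}) L" "continuous_on ({-1..-c} \<times> {-1..1}) L"
    using continuous_on_subset by metis+
  then have "compact P" "compact Q"
    unfolding P_def Q_def by (auto intro!: compact_continuous_image compact_Times)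
  moreover have "P \<inter> Q = {}"
  proof -
    have "P \<subseteq> L ` ({0<..1} \<times> {-1..1})" "Q \<subseteq> L ` ({-1..<0} \<times> {-1..1})"
      unfolding P_def Q_def using c by (auto intro!: image_mono)
    with D(8) show ?thesis by blast
  qed
  ultimately obtain d where d: "d > 0" "\<And>p q. p \<in> P \<Longrightarrow> q \<in> Q \<Longrightarrow> d \<le> dist p q"
    using separate_compact_closed[of P Q] compact_imp_closed[of Q] by metis
  show ?thesis
  proof
    show "min 1 (d / 2) > 0" using d by simp
    fix \<mu> :: real and p q :: "real \<times> real"
    assume \<mu>: "0 \<le> \<mu>" "\<mu> < min 1 (d / 2)"
      and pq: "p \<in> {0<..1} \<times> {-1..1}" "q \<in> {-1..<0} \<times> {-1..1}"
    obtain x y x' y' where [simp]: "p = (x, y)" "q = (x', y')" by (cases p, cases q)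
    show "shifted L \<mu> p \<noteq> shifted L \<mu> q"
    proof
      assume eq: "shifted L \<mu> p = shifted L \<mu> q"
      have fst_eq: "\<alpha> x - \<alpha> x' = \<mu> * (x - x')" and snd_eq: "\<beta> x y = \<beta> x' y'"
        using eq pq D(4)[of x y] D(4)[of x' y'] by (auto simp: shifted_def algebra_simps)
      have "0 \<le> sqrt 2 * (x' - - 1)" "0 \<le> sqrt 2 * (1 - x)" using pq by auto
      moreover have "sqrt 2 * (x' - - 1) \<le> \<alpha> x' - \<alpha> (- 1)" "sqrt 2 * (1 - x) \<le> \<alpha> 1 - \<alpha> x"
        using pq by (intro lorenz_base_expand_left[OF D(5)] lorenz_base_expand_right[OF D(5)]; simp)+
      moreover have "\<alpha> (- 1) = - \<alpha> 1" using B(4)[of 1] by simp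
      ultimately have "\<alpha> x' \<ge> - \<alpha> 1" "\<alpha> x \<le> \<alpha> 1" by linarith+
      moreover have "0 \<le> \<mu> * (x - x')" using pq \<mu> by (intro mult_nonneg_nonneg) auto
      ultimately have "\<alpha> x \<ge> - \<alpha> 1" "\<alpha> x' \<le> \<alpha> 1" using fst_eq by linarith+
      then have "x \<ge> c" "- x' \<ge> c"
        using b(2)[of x] b(2)[of "- x'"] B(4)[of x'] pq by (force simp: c_def not_less[symmetric])+
      then have "d \<le> dist (L p) (L q)"
        using pq by (intro d(2)) (auto simp: P_def Q_def)
      also have "\<dots> = \<mu> * (x - x')"
        using pq D(4)[of x y] D(4)[of x' y'] fst_eq snd_eq \<open>0 \<le> \<mu> * (x - x')\<close>
        by (auto simp: dist_prod_def dist_real_def)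
      also have "\<dots> \<le> \<mu> * 2" using pq \<mu> by (intro mult_left_mono) auto
      finally show False using \<mu> by simp
    qed
  qed
qed

lemma uniform_limit_shifted:
  assumes "uniform_limit {-1..1} (\<lambda>x y. L (x, y)) (\<lambda>y. v) F" and "((\<lambda>x. x) \<longlongrightarrow> 0) F"
  shows "uniform_limit {-1..1} (\<lambda>x y. shifted L \<mu> (x, y)) (\<lambda>y. v) F"
proof -
  have "uniform_limit {-1..1} (\<lambda>x (y::real). (\<mu> * x, 0 :: real)) (\<lambda>y. (0, 0)) F"
    unfolding uniform_limit_iff
  proof (intro allI impI)
    fix e :: real assume "e > 0"
    have "((\<lambda>x. (\<mu> * x, 0 :: real)) \<longlongrightarrow> (0, 0)) F"
      using assms(2) by (auto intro!: tendsto_eq_intros)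
    then show "\<forall>\<^sub>F x in F. \<forall>y\<in>{-1..1::real}. dist (\<mu> * x, 0 :: real) (0, 0) < e"
      using \<open>e > 0\<close> by (auto simp: tendsto_iff elim: eventually_mono)
  qed
  from uniform_limit_minus[OF assms(1) this]
  show ?thesis by (simp add: shifted_def zero_prod_def[symmetric])
qed

lemma vertex_shifted:
  shows "vertex_pos L v \<Longrightarrow> vertex_pos (shifted L \<mu>) v"
    and "vertex_neg L v \<Longrightarrow> vertex_neg (shifted L \<mu>) v"
  unfolding vertex_pos_def vertex_neg_def
  by (simp_all add: uniform_limit_shifted tendsto_ident_at)

proposition lorenz_map_shifted:
  assumes "lorenz_map_with L \<alpha> \<beta>"
  obtains \<mu>0 where "0 < \<mu>0" "\<mu>0 < 1" "\<And>\<mu>. \<mu> \<in> {0..\<mu>0} \<Longrightarrow> lorenz_map (shifted L \<mu>)"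
proof -
  note D = lorenz_map_withD[OF assms]
  note B = lorenz_baseD[OF D(5)]
  obtain m where m: "m > sqrt 2" "\<And>x. x \<in> {0<..1} \<Longrightarrow> m \<le> alpha_deriv \<alpha> x"
    using alpha_deriv_uniform_gap[OF D(5)] by metis
  obtain r where r: "r > 0" "\<And>\<mu> p q. 0 \<le> \<mu> \<Longrightarrow> \<mu> < r \<Longrightarrow> p \<in> {0<..1} \<times> {-1..1} \<Longrightarrow>
      q \<in> {-1..<0} \<times> {-1..1} \<Longrightarrow> shifted L \<mu> p \<noteq> shifted L \<mu> q"
    using cusp_images_separated[OF assms] by metis
  define \<mu>0 where "\<mu>0 = min (1/2) (min ((m - sqrt 2) / 2) (r / 2))"
  show ?thesis
  proof
    show "0 < \<mu>0" "\<mu>0 < 1" using m(1) r(1) by (auto simp: \<mu>0_def min_less_iff_disj)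
    fix \<mu> assume "\<mu> \<in> {0..\<mu>0}"
    then have \<mu>: "0 \<le> \<mu>" "\<mu> < 1" "\<mu> < m - sqrt 2" "\<mu> < r"
      using m(1) r(1) by (auto simp: \<mu>0_def)
    define \<gamma> where "\<gamma> = (\<lambda>x. \<alpha> x - \<mu> * x)"
    have \<gamma>: "lorenz_base \<gamma>"
      unfolding \<gamma>_def by (rule lorenz_base_shift[OF D(5) m]) (use \<mu> in auto)
    note G = lorenz_baseD[OF \<gamma>]
    have eq: "shifted L \<mu> (x, y) = (\<gamma> x, \<beta> x y)" if "x \<in> {-1..1} - {0}" "y \<in> {-1..1}" for x y
      using D(4)[OF that] by (simp add: shifted_def \<gamma>_def)
    have right: "1 * \<bar>x - y\<bar> \<le> \<bar>\<gamma> x - \<gamma> y\<bar>" if "x \<in> {0<..1}" "y \<in> {0<..1}" for x y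
    proof -
      have *: "1 * (y - x) \<le> \<gamma> y - \<gamma> x" if "0 < x" "x \<le> y" "y \<le> 1" for x y
      proof -
        have "1 * (y - x) \<le> sqrt 2 * (y - x)" using that sqrt_2_bounds by (intro mult_right_mono) auto
        with lorenz_base_expand_right[OF \<gamma> that] show ?thesis by linarith
      qed
      from *[of x y] *[of y x] that show ?thesis by (cases "x \<le> y") auto
    qed
    have left: "1 * \<bar>x - y\<bar> \<le> \<bar>\<gamma> x - \<gamma> y\<bar>" if "x \<in> {-1..<0}" "y \<in> {-1..<0}" for x y
      using right[of "- x" "- y"] that G(4)[of x] G(4)[of y] by (auto simp: abs_minus_commute)
    have "lorenz_map_with (shifted L \<mu>) \<gamma> \<beta>"
      unfolding lorenz_map_with_def \<Sigma>_pos_eq \<Sigma>_neg_eq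
    proof (intro conjI allI impI)
      have coord: "x \<in> {-1..1} - {0}" "y \<in> {-1..1}" if "(x, y) \<in> \<Sigma> - \<Gamma>" for x y
        using that by (auto simp: \<Sigma>_def \<Gamma>_def)
      show "shifted L \<mu> \<in> \<Sigma> - \<Gamma> \<rightarrow> \<Sigma>"
      proof
        fix p assume p: "p \<in> \<Sigma> - \<Gamma>"
        obtain x y where [simp]: "p = (x, y)" by (cases p)
        from coord[of x y] p have xy: "x \<in> {-1..1} - {0}" "y \<in> {-1..1}" by simp_all
        from eq[OF xy] G(1)[OF xy(1)] D(6)[OF xy] show "shifted L \<mu> p \<in> \<Sigma>"
          by (auto simp: \<Sigma>_def)
      qed
      show "C1_diffeo_on (shifted L \<mu>) ({0<..1} \<times> {-1..1})"
        by (rule C1_diffeo_on_change_base[OF D(2) _ _ B(3) G(3) _ right at_within_interval_neq_bot(1)])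
          (use D(4) eq in auto)
      show "C1_diffeo_on (shifted L \<mu>) ({-1..<0} \<times> {-1..1})"
        by (rule C1_diffeo_on_change_base[OF D(3) _ _ B(2) G(2) _ left at_within_interval_neq_bot(2)])
          (use D(4) eq in auto)
      show "shifted L \<mu> (x, y) = (\<gamma> x, \<beta> x y)" "\<beta> x y \<in> {-1..1}" if "(x, y) \<in> \<Sigma> - \<Gamma>" for x y
        using eq[OF coord[OF that]] D(6)[OF coord[OF that]] by simp_all
      show "shifted L \<mu> ` ({0<..1} \<times> {-1..1}) \<inter> shifted L \<mu> ` ({-1..<0} \<times> {-1..1}) = {}"
        using r(2)[OF \<mu>(1) \<mu>(4)] by blast
      show "\<exists>v\<in>{-1} \<times> {-1..1}. vertex_pos (shifted L \<mu>) v"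
        using D(9) vertex_shifted(1) by blast
      show "\<exists>v\<in>{1} \<times> {-1..1}. vertex_neg (shifted L \<mu>) v"
        using D(10) vertex_shifted(2) by blast
    qed (use \<gamma> D(7) in auto)
    then show "lorenz_map (shifted L \<mu>)" unfolding lorenz_map_def by blast
  qed
qed

section \<open>Shadowing on the base interval\<close>

lemma pull_back_point:
  fixes f :: "'a \<Rightarrow> 'a"
  assumes "u \<in> K n" and "\<And>i. i < n \<Longrightarrow> K (Suc i) \<subseteq> f ` K i"
  shows "\<exists>w. (\<forall>i\<le>n. (f ^^ i) w \<in> K i) \<and> (f ^^ n) w = u"
  using assms
proof (induction n arbitrary: u)
  case 0
  then show ?case by auto
next
  case (Suc n)
  then obtain v where v: "v \<in> K n" "u = f v" by blast
  obtain w where "\<forall>i\<le>n. (f ^^ i) w \<in> K i" "(f ^^ n) w = v"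
    using Suc.IH[OF v(1)] Suc.prems(2) by auto
  with v Suc.prems(1) show ?case
    by (intro exI[of _ w]) (auto simp: le_Suc_eq)
qed

text \<open>
  Finite itineraries are realised by pulling back points; a limit of their initial points realises
  the infinite itinerary, because \<open>f\<close> is continuous on each \<open>K n\<close> even if it is not continuous on
  a neighbourhood.
\<close>

lemma covering_compact_orbit:
  fixes f :: "'a::metric_space \<Rightarrow> 'a"
  assumes compact: "\<And>n. compact (K n)" and ne: "\<And>n. K n \<noteq> {}"
    and cont: "\<And>n. continuous_on (K n) f" and cover: "\<And>n. K (Suc n) \<subseteq> f ` K n"
  shows "\<exists>z. \<forall>n. (f ^^ n) z \<in> K n"
proof -
  have "\<exists>w. \<forall>i\<le>n. (f ^^ i) w \<in> K i" for n
    using pull_back_point[of _ K n f] ne[of n] cover by blast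
  then obtain w where w: "\<And>n i. i \<le> n \<Longrightarrow> (f ^^ i) (w n) \<in> K i" by metis
  have "\<forall>n. w n \<in> K 0" using w[of 0] by simp
  then obtain z r where z: "z \<in> K 0" and r: "strict_mono r" "(w \<circ> r) \<longlonglongrightarrow> z"
    using compact[of 0] unfolding compact_def by meson
  have "(f ^^ i) z \<in> K i \<and> (\<lambda>n. (f ^^ i) (w (r n))) \<longlonglongrightarrow> (f ^^ i) z" for i
  proof (induction i)
    case 0
    with z r show ?case by (simp add: o_def)
  next
    case (Suc i)
    have late: "\<forall>\<^sub>F n in sequentially. (f ^^ j) (w (r n)) \<in> K j" for j
      using eventually_ge_at_top[of j]
      by eventually_elim (meson w r(1) le_trans seq_suble)
    have lim: "(\<lambda>n. (f ^^ Suc i) (w (r n))) \<longlonglongrightarrow> (f ^^ Suc i) z"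
      using continuous_on_tendsto_compose[OF cont[of i] _ _ late[of i]] Suc by simp
    have "(f ^^ Suc i) z \<in> K (Suc i)"
      by (rule Lim_in_closed_set[OF compact_imp_closed[OF compact] late _ lim]) simp
    with lim show ?case by blast
  qed
  then show ?thesis by blast
qed

text \<open>
  Here \<open>e\<close> is the shadowing accuracy on the base, \<open>\<mu> / 100\<close> is both the size of the jumps of the
  pseudo-orbit and the tolerance for end points. The cut-off \<open>\<tau>\<close> keeps intervals away from
  the discontinuity: its image is so close to the limit value \<open>-1\<close> that nothing essential is lost.
\<close>

locale shifted_line_dynamics =
  fixes \<alpha> :: "real \<Rightarrow> real" and \<mu> e \<tau> :: real
  assumes base: "lorenz_base \<alpha>"
    and critical: "4 / 5 < \<alpha> (\<alpha> 1)" "\<alpha> (\<alpha> 1) < \<alpha> 1"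
    and slow_deriv: "\<And>x. 4 / 5 < x \<Longrightarrow> x \<le> 1 \<Longrightarrow> alpha_deriv \<alpha> x < 2"
    and \<mu>: "0 < \<mu>" "\<mu> \<le> 1 / 20" "3 * \<mu> < \<alpha> (\<alpha> 1) - 4 / 5" "3 * \<mu> \<le> e"
    and \<tau>: "0 < \<tau>" "\<tau> \<le> \<mu>" "\<alpha> \<tau> \<le> -1 + \<mu> / 100"
begin

lemma base_range: "x \<noteq> 0 \<Longrightarrow> \<bar>x\<bar> \<le> 1 \<Longrightarrow> \<bar>\<alpha> x\<bar> \<le> 1"
  using lorenz_baseD(1)[OF base, of x] by (auto simp: abs_le_iff)

lemma base_odd: "x \<noteq> 0 \<Longrightarrow> \<bar>x\<bar> \<le> 1 \<Longrightarrow> \<alpha> (- x) = - \<alpha> x"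
  using lorenz_baseD(4)[OF base, of x] by (auto simp: abs_le_iff)

lemma expand: "7 / 5 * (y - x) \<le> \<alpha> y - \<alpha> x" if "0 < x" "x \<le> y" "y \<le> 1"
proof -
  have "7 / 5 * (y - x) \<le> sqrt 2 * (y - x)"
    using that sqrt_2_bounds by (intro mult_right_mono) auto
  with lorenz_base_expand_right[OF base that] show ?thesis by linarith
qed

lemma lower: "-1 + 7 / 5 * x \<le> \<alpha> x" if "0 < x" "x \<le> 1"
proof -
  have "7 / 5 * x \<le> sqrt 2 * x"
    using that sqrt_2_bounds by (intro mult_right_mono) auto
  with lorenz_base_lower[OF base that] show ?thesis by linarith
qed

lemma slow: "\<alpha> y - \<alpha> x \<le> 2 * (y - x)" if "4 / 5 < x" "x \<le> y" "y \<le> 1"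
  by (rule mvt_upper[of _ _ "{0<..1}", OF _ _ alpha_deriv_works(1)[OF lorenz_baseD(3)[OF base]]])
    (use that in \<open>auto intro: less_imp_le[OF slow_deriv]\<close>)

lemma critical_order: "\<alpha> 1 < 1"
  using lorenz_baseD(6)[OF base] .

text \<open>
  Invariant for the part of a trapping interval to the right of the pseudo-orbit point \<open>x\<close>, where
  \<open>b\<close> is the right end point. In the last alternative the room is wide: \<open>13 / 5 * \<mu>\<close> reproduces
  itself, because a step multiplies it by at least \<open>7 / 5 < sqrt 2\<close> and costs at most
  \<open>\<mu> + \<mu> / 100\<close>. An interval that has just been cut at the discontinuity may have no room at all.
  Its end point then follows the critical orbit \<open>1\<close>, \<open>\<alpha> 1\<close>, \<open>\<alpha> (\<alpha> 1)\<close>, and the first three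
  alternatives record this together with the room gained so far. The errors \<open>2\<close> and \<open>4\<close> times
  \<open>\<mu> / 100\<close> come from the bound \<open>2\<close> on the derivative near \<open>1\<close>. The room on the left is
  \<open>room (- x) (- a)\<close>, by the symmetry of \<open>\<alpha>\<close>.
\<close>

definition room :: "real \<Rightarrow> real \<Rightarrow> bool" where
  "room x b \<longleftrightarrow>
    1 - \<mu> / 100 \<le> b \<and> - (\<mu> / 100) \<le> b - x \<or>
    \<alpha> 1 - 2 * (\<mu> / 100) \<le> b \<and> 3 / 4 * \<mu> \<le> b - x \<or>
    \<alpha> (\<alpha> 1) - 4 * (\<mu> / 100) \<le> b \<and> 9 / 5 * \<mu> \<le> b - x \<or>
    13 / 5 * \<mu> \<le> b - x"

lemma room_cases:
  assumes "room x b"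
  obtains (first) "1 - \<mu> / 100 \<le> b" "- (\<mu> / 100) \<le> b - x"
  | (second) "\<alpha> 1 - 2 * (\<mu> / 100) \<le> b" "3 / 4 * \<mu> \<le> b - x"
  | (third) "\<alpha> (\<alpha> 1) - 4 * (\<mu> / 100) \<le> b" "9 / 5 * \<mu> \<le> b - x"
  | (wide) "13 / 5 * \<mu> \<le> b - x"
  using assms unfolding room_def by argo

lemma room_far_or_wide:
  assumes "room x b"
  shows "4 / 5 + 29 / 10 * \<mu> < b \<or> 13 / 5 * \<mu> \<le> b - x"
  using assms by (cases rule: room_cases) (use critical critical_order \<mu> in linarith)+

text \<open>
  A pseudo-orbit step of \<open>\<alpha> x - \<mu> * x\<close>. The sign \<open>s\<close> selects the side of the discontinuity on which
  the shadowing orbit runs; it is a genuine choice only for \<open>x = 0\<close>, where the image is read as the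
  one-sided limit \<open>- s\<close>.
\<close>

definition noisy_step :: "real \<Rightarrow> real \<Rightarrow> real \<Rightarrow> bool" where
  "noisy_step s x x' \<longleftrightarrow> \<bar>s\<bar> = 1 \<and> 0 \<le> s * x \<and> \<bar>x\<bar> \<le> 1 \<and> \<bar>x'\<bar> \<le> 1 \<and>
    \<bar>(if x = 0 then - s else \<alpha> x - \<mu> * x) - x'\<bar> \<le> \<mu> / 100"

lemma noisy_stepD:
  assumes "noisy_step 1 x x'"
  shows "0 \<le> x" "x \<le> 1" "\<bar>x'\<bar> \<le> 1" "x = 0 \<Longrightarrow> x' \<le> -1 + \<mu> / 100"
    and "0 < x \<Longrightarrow> \<bar>\<alpha> x - \<mu> * x - x'\<bar> \<le> \<mu> / 100"
  using assms unfolding noisy_step_def by (auto simp: abs_le_iff)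

lemma noisy_step_uminus:
  assumes "noisy_step s x x'"
  shows "noisy_step (- s) (- x) (- x')"
  using assms base_odd[of x] unfolding noisy_step_def
  by (cases "x = 0") (simp_all add: abs_minus_commute algebra_simps)

text \<open>
  The end point away from the discontinuity is mapped by \<open>\<alpha>\<close>, the pseudo-orbit by \<open>\<alpha> x - \<mu> * x\<close>,
  so on the right side the shift adds \<open>\<mu> * x\<close> to the room. Along the critical orbit
  \<open>x > 4 / 5\<close>, and three such gains, expanded by \<open>sqrt 2\<close>, make the room wide:
  about \<open>0\<close>, then \<open>3 / 4\<close>, \<open>9 / 5\<close> and \<open>13 / 5\<close> times \<open>\<mu>\<close>.
\<close>

lemma room_outer:
  assumes "noisy_step 1 x x'" and "b \<le> 1" and "room x b"
  shows "\<tau> < b" and "room x' (\<alpha> b)"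
proof -
  note step = noisy_stepD[OF assms(1)]
  show b: "\<tau> < b"
    using room_far_or_wide[OF assms(3)] step(1) \<mu> \<tau> by linarith
  show "room x' (\<alpha> b)"
  proof (cases "13 / 5 * \<mu> \<le> b - x")
    case wide: True
    have "13 / 5 * \<mu> \<le> \<alpha> b - x'"
    proof (cases "x = 0")
      case True
      have "-1 + 7 / 5 * b \<le> \<alpha> b" using lower b \<tau> assms(2) by simp
      with step(4)[OF True] wide True \<mu> show ?thesis by linarith
    next
      case False
      then have "x > 0" using step(1) by simp
      moreover have "7 / 5 * (b - x) \<le> \<alpha> b - \<alpha> x"
        using expand[of x b] \<open>x > 0\<close> wide \<mu> assms(2) by argo
      moreover have "0 \<le> \<mu> * x" using \<mu> \<open>x > 0\<close> by simp
      ultimately show ?thesis using wide \<mu>(1) step(5)[OF \<open>x > 0\<close>] by argo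
    qed
    then show ?thesis by (simp add: room_def)
  next
    case False
    then have b8: "4 / 5 < b" and x8: "4 / 5 < x"
      using room_far_or_wide[OF assms(3)] \<mu> by linarith+
    have "\<mu> * (4 / 5) \<le> \<mu> * x" using \<mu> x8 by (intro mult_left_mono) auto
    then have gain: "\<alpha> b - \<alpha> x + 79 / 100 * \<mu> \<le> \<alpha> b - x'"
      using \<mu> x8 step(5) by argo
    show ?thesis
      using assms(3)
    proof (cases rule: room_cases)
      case first
      have "\<alpha> 1 - \<alpha> b \<le> 2 * (1 - b)" using slow[of b 1] b8 assms(2) by simp
      moreover have "- 2 * (\<mu> / 100) \<le> \<alpha> b - \<alpha> x"
      proof (cases "x \<le> b")
        case True
        then have "0 \<le> \<alpha> b - \<alpha> x" using expand[of x b] x8 assms(2) by argo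
        then show ?thesis using \<mu> by linarith
      next
        case False
        then have "\<alpha> x - \<alpha> b \<le> 2 * (x - b)" using slow[of b x] b8 step(2) by argo
        then show ?thesis using first by argo
      qed
      ultimately have "\<alpha> 1 - 2 * (\<mu> / 100) \<le> \<alpha> b" "3 / 4 * \<mu> \<le> \<alpha> b - x'"
        using gain first \<mu>(1) by argo+
      then show ?thesis unfolding room_def by blast
    next
      case second
      \<comment> \<open>the end point may be off the critical orbit on either side\<close>
      have "\<alpha> (\<alpha> 1) - \<alpha> b \<le> 4 * (\<mu> / 100)"
      proof (cases "b \<le> \<alpha> 1")
        case True
        then have "\<alpha> (\<alpha> 1) - \<alpha> b \<le> 2 * (\<alpha> 1 - b)" using slow[of b "\<alpha> 1"] b8 critical_order by argo
        then show ?thesis using second by argo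
      next
        case False
        then have "0 \<le> \<alpha> b - \<alpha> (\<alpha> 1)" using expand[of "\<alpha> 1" b] critical assms(2) by argo
        then show ?thesis using \<mu> by linarith
      qed
      moreover have "7 / 5 * (b - x) \<le> \<alpha> b - \<alpha> x"
        using expand[of x b] x8 second \<mu> assms(2) by argo
      ultimately have "\<alpha> (\<alpha> 1) - 4 * (\<mu> / 100) \<le> \<alpha> b" "9 / 5 * \<mu> \<le> \<alpha> b - x'"
        using gain second \<mu>(1) by argo+
      then show ?thesis unfolding room_def by blast
    next
      case third
      moreover have "7 / 5 * (b - x) \<le> \<alpha> b - \<alpha> x"
        using expand[of x b] x8 third \<mu> assms(2) by argo
      ultimately have "13 / 5 * \<mu> \<le> \<alpha> b - x'"
        using gain \<mu>(1) by argo
      then show ?thesis unfolding room_def by blast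
    next
      case wide
      with False show ?thesis by simp
    qed
  qed
qed

text \<open>
  For the end point on the side of the discontinuity there are two possibilities. If the interval
  reaches \<open>\<tau>\<close> it is cut there, and the recovery along the critical orbit starts afresh. Otherwise the
  end point is positive, so that the room on the left is already wide; then it remains wide although
  the shift now works against it.
\<close>

lemma room_inner:
  assumes "noisy_step 1 x x'" and "room (- x) (- a)"
  shows "room (- x') (- \<alpha> (max a \<tau>))"
proof (cases "a \<le> \<tau>")
  case True
  then have "max a \<tau> = \<tau>" by simp
  with \<tau>(3) noisy_stepD(3)[OF assms(1)] show ?thesis
    unfolding room_def by (intro disjI1) (auto simp: abs_le_iff)
next
  case False
  note step = noisy_stepD[OF assms(1)]
  have wide: "13 / 5 * \<mu> \<le> x - a" and a: "0 < a" "a < x"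
    using room_far_or_wide[OF assms(2)] False \<tau> \<mu> by linarith+
  have "7 / 5 * (x - a) \<le> \<alpha> x - \<alpha> a" using expand[of a x] a step(2) by argo
  moreover have "\<mu> * x \<le> \<mu> * 1" using \<mu> step(2) by (intro mult_left_mono) auto
  ultimately have "13 / 5 * \<mu> \<le> x' - \<alpha> a" using wide step(5) a \<mu> by argo
  with False show ?thesis unfolding room_def by (simp add: max_def)
qed

text \<open>
  Right after a cut the interval may miss \<open>x\<close> by \<open>\<mu> / 100\<close> on one side, but then its end point on
  that side is nearly \<open>1\<close> or \<open>-1\<close>, and the other end point cannot lie beyond it.
\<close>

lemma room_nonempty:
  assumes "\<bar>x\<bar> \<le> 1" and "room x b" and "room (- x) (- a)"
  shows "a \<le> b"
proof (cases "1 - \<mu> / 100 \<le> b \<or> 1 - \<mu> / 100 \<le> - a")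
  case True
  then show ?thesis
    using room_far_or_wide[OF assms(2)] room_far_or_wide[OF assms(3)] assms(1) \<mu>
    by (elim disjE) (use \<mu> in \<open>simp_all add: abs_le_iff\<close>; linarith)+
next
  case False
  have "0 \<le> b - x"
    using assms(2) by (cases rule: room_cases) (use False \<mu> in linarith)+
  moreover have "0 \<le> x - a"
    using assms(3) by (cases rule: room_cases) (use False \<mu> in linarith)+
  ultimately show ?thesis by simp
qed

definition trap :: "real \<Rightarrow> real \<Rightarrow> real \<Rightarrow> bool" where
  "trap x a b \<longleftrightarrow> -1 \<le> a \<and> x - e \<le> a \<and> a \<le> b \<and> b \<le> x + e \<and> b \<le> 1 \<and>
    room x b \<and> room (- x) (- a)"

lemma room_window: "room x (x + e)"
  using \<mu> unfolding room_def by simp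

lemma trap_initial:
  assumes "\<bar>x\<bar> \<le> 1"
  shows "trap x (max (x - e) (-1)) (min (x + e) 1)"
proof -
  have "room y (min (y + e) 1)" if "\<bar>y\<bar> \<le> 1" for y
  proof (cases "y + e \<le> 1")
    case True
    then show ?thesis using room_window[of y] by (simp add: min_def)
  next
    case False
    then have "min (y + e) 1 = 1" by simp
    then show ?thesis using that \<mu> by (simp add: room_def abs_le_iff)
  qed
  from this[of x] this[of "- x"] have "room x (min (x + e) 1)" "room (- x) (min (- x + e) 1)"
    using assms by simp_all
  moreover have "min (- x + e) 1 = - max (x - e) (-1)" by (simp add: min_def max_def)
  ultimately show ?thesis
    using assms \<mu> unfolding trap_def by (auto simp: abs_le_iff)
qed

lemma trap_uminus: "trap x a b \<Longrightarrow> trap (- x) (- b) (- a)"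
  by (auto simp: trap_def)

text \<open>
  The image of the part of the interval on the right of \<open>\<tau>\<close> is cut down to the window of radius
  \<open>e\<close> around \<open>x'\<close>. Where the window is the smaller one, the room is \<open>e \<ge> 3 * \<mu>\<close>.
\<close>

lemma trap_step_right:
  assumes "trap x a b" and "noisy_step 1 x x'"
  shows "\<exists>a' b' c d. trap x' a' b' \<and> a \<le> c \<and> c \<le> d \<and> d \<le> b \<and> 0 < c \<and> {a'..b'} \<subseteq> \<alpha> ` {c..d}"
proof -
  have trap: "-1 \<le> a" "x - e \<le> a" "a \<le> b" "b \<le> x + e" "b \<le> 1" "room x b" "room (- x) (- a)"
    using assms(1) by (auto simp: trap_def)
  note step = noisy_stepD[OF assms(2)]
  define c where "c = max a \<tau>"
  define a' where "a' = max (\<alpha> c) (x' - e)"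
  define b' where "b' = min (\<alpha> b) (x' + e)"
  note outer = room_outer[OF assms(2) trap(5,6)]
  have c: "0 < c" "c \<le> b" "c \<le> 1" "a \<le> c"
    using \<tau> trap outer(1) by (auto simp: c_def)
  have rb: "room x' b'"
    using outer(2) room_window[of x'] by (simp add: b'_def min_def)
  have "room (- x') (- \<alpha> c)"
    using room_inner[OF assms(2) trap(7)] by (simp add: c_def)
  then have ra: "room (- x') (- a')"
    using room_window[of "- x'"] by (auto simp: a'_def max_def)
  have "a' \<le> b'" by (rule room_nonempty[OF step(3) rb ra])
  moreover have "-1 \<le> a'" "b' \<le> 1"
    using base_range[of c] base_range[of b] c trap(5) by (auto simp: a'_def b'_def abs_le_iff)
  moreover have "x' - e \<le> a'" "b' \<le> x' + e" by (auto simp: a'_def b'_def)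
  ultimately have "trap x' a' b'" using ra rb by (simp add: trap_def)
  moreover have "{a'..b'} \<subseteq> \<alpha> ` {c..b}"
  proof
    fix u assume "u \<in> {a'..b'}"
    then have "\<alpha> c \<le> u" "u \<le> \<alpha> b" by (auto simp: a'_def b'_def)
    moreover have "continuous_on {c..b} \<alpha>"
      by (rule continuous_on_subset[OF C1_on_imp_continuous_on[OF lorenz_baseD(3)[OF base]]])
        (use c trap(5) in auto)
    ultimately show "u \<in> \<alpha> ` {c..b}" using IVT'[of \<alpha> c u b] c(2) by fastforce
  qed
  ultimately show ?thesis using c by blast
qed

lemma trap_step:
  assumes "trap x a b" and "noisy_step s x x'"
  shows "\<exists>a' b' c d. trap x' a' b' \<and> a \<le> c \<and> c \<le> d \<and> d \<le> b \<and> (\<forall>u\<in>{c..d}. 0 < s * u) \<and>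
    {a'..b'} \<subseteq> \<alpha> ` {c..d}"
proof -
  consider "s = 1" | "s = -1"
    using assms(2) by (auto simp: noisy_step_def abs_if split: if_splits)
  then show ?thesis
  proof cases
    case 1
    obtain a' b' c d where "trap x' a' b'" "a \<le> c" "c \<le> d" "d \<le> b" "0 < c" "{a'..b'} \<subseteq> \<alpha> ` {c..d}"
      using trap_step_right[OF assms(1)] assms(2) 1 by blast
    with 1 show ?thesis
      by (intro exI[of _ a'] exI[of _ b'] exI[of _ c] exI[of _ d]) auto
  next
    case 2
    have "noisy_step 1 (- x) (- x')"
      using noisy_step_uminus[OF assms(2)] 2 by simp
    from trap_step_right[OF trap_uminus[OF assms(1)] this]
    obtain a' b' c d where *: "trap (- x') a' b'" "- b \<le> c" "c \<le> d" "d \<le> - a" "0 < c"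
      "{a'..b'} \<subseteq> \<alpha> ` {c..d}" by blast
    have d: "d \<le> 1" using * assms(1) by (simp add: trap_def)
    have "{- b'..- a'} \<subseteq> \<alpha> ` {- d..- c}"
    proof
      fix u assume "u \<in> {- b'..- a'}"
      then have "- u \<in> {a'..b'}" by auto
      then obtain t where t: "t \<in> {c..d}" "- u = \<alpha> t" using *(6) by blast
      then have "u = \<alpha> (- t)" using base_odd[of t] * d by auto
      then show "u \<in> \<alpha> ` {- d..- c}" using t(1) by auto
    qed
    moreover have "trap x' (- b') (- a')" using trap_uminus[OF *(1)] by simp
    ultimately show ?thesis
      using * 2
      by (intro exI[of _ "- b'"] exI[of _ "- a'"] exI[of _ "- d"] exI[of _ "- c"]) auto
  qed
qed

text \<open>
  All alternatives of the invariant except the wide one force the end point to have absolute value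
  greater than \<open>4 / 5\<close>, and the wide one at \<open>x = 0\<close> also puts it on its own side of \<open>0\<close>. This is why a
  pseudo-orbit ending on the discontinuity is shadowed by an orbit ending exactly there.
\<close>

lemma trap_contains_0:
  assumes "trap 0 a b"
  shows "0 \<in> {a..b}"
  using room_far_or_wide[of 0 b] room_far_or_wide[of 0 "- a"] assms \<mu>
  by (simp add: trap_def) argo

lemma trapping_intervals:
  assumes "\<bar>X 0\<bar> \<le> 1"
  shows "\<exists>A B C D. \<forall>n.
    ((\<forall>i<n. noisy_step (s i) (X i) (X (Suc i))) \<longrightarrow> trap (X n) (A n) (B n)) \<and>
    ((\<forall>i\<le>n. noisy_step (s i) (X i) (X (Suc i))) \<longrightarrow>
      A n \<le> C n \<and> C n \<le> D n \<and> D n \<le> B n \<and> (\<forall>u\<in>{C n..D n}. 0 < s n * u) \<and>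
      {A (Suc n)..B (Suc n)} \<subseteq> \<alpha> ` {C n..D n})"
proof -
  define good where "good n \<longleftrightarrow> (\<forall>i<n. noisy_step (s i) (X i) (X (Suc i)))" for n
  define P where "P n I \<longleftrightarrow> (good n \<longrightarrow> trap (X n) (fst I) (snd I))" for n and I :: "real \<times> real"
  define Q where "Q n I J \<longleftrightarrow> (good (Suc n) \<longrightarrow> (\<exists>c d. fst I \<le> c \<and> c \<le> d \<and> d \<le> snd I \<and>
      (\<forall>u\<in>{c..d}. 0 < s n * u) \<and> {fst J..snd J} \<subseteq> \<alpha> ` {c..d}))" for n and I J :: "real \<times> real"
  have "\<exists>I. \<forall>n. P n (I n) \<and> Q n (I n) (I (Suc n))"
  proof (rule dependent_nat_choice)
    show "\<exists>I. P 0 I"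
      using trap_initial[OF assms] unfolding P_def by auto
    fix I n assume PI: "P n I"
    show "\<exists>J. P (Suc n) J \<and> Q n I J"
    proof (cases "good (Suc n)")
      case True
      then have "good n" "noisy_step (s n) (X n) (X (Suc n))" by (auto simp: good_def)
      with PI obtain a' b' c d where "trap (X (Suc n)) a' b'" "fst I \<le> c" "c \<le> d" "d \<le> snd I"
        "\<forall>u\<in>{c..d}. 0 < s n * u" "{a'..b'} \<subseteq> \<alpha> ` {c..d}"
        unfolding P_def using trap_step by meson
      then show ?thesis
        unfolding P_def Q_def by (intro exI[of _ "(a', b')"]) auto
    qed (auto simp: P_def Q_def)
  qed
  then obtain I where I: "\<And>n. P n (I n)" "\<And>n. Q n (I n) (I (Suc n))" by blast
  from I(2) obtain C D where CD: "\<And>n. good (Suc n) \<Longrightarrow> fst (I n) \<le> C n \<and> C n \<le> D n \<and> D n \<le> snd (I n) \<and>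
      (\<forall>u\<in>{C n..D n}. 0 < s n * u) \<and> {fst (I (Suc n))..snd (I (Suc n))} \<subseteq> \<alpha> ` {C n..D n}"
    unfolding Q_def by metis
  show ?thesis
  proof (intro exI allI)
    fix n
    have "trap (X n) (fst (I n)) (snd (I n))" if "\<forall>i<n. noisy_step (s i) (X i) (X (Suc i))"
      using I(1)[of n] that unfolding P_def good_def by blast
    moreover have "good (Suc n)" if "\<forall>i\<le>n. noisy_step (s i) (X i) (X (Suc i))"
      using that by (simp add: good_def less_Suc_eq_le)
    ultimately show "((\<forall>i<n. noisy_step (s i) (X i) (X (Suc i))) \<longrightarrow> trap (X n) (fst (I n)) (snd (I n))) \<and>
      ((\<forall>i\<le>n. noisy_step (s i) (X i) (X (Suc i))) \<longrightarrow>
        fst (I n) \<le> C n \<and> C n \<le> D n \<and> D n \<le> snd (I n) \<and> (\<forall>u\<in>{C n..D n}. 0 < s n * u) \<and>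
        {fst (I (Suc n))..snd (I (Suc n))} \<subseteq> \<alpha> ` {C n..D n})"
      using CD[of n] by argo
  qed
qed

definition shadows_at :: "real \<Rightarrow> real \<Rightarrow> real \<Rightarrow> bool" where
  "shadows_at s x u \<longleftrightarrow> \<bar>u - x\<bar> \<le> e \<and> \<bar>u\<bar> \<le> 1 \<and> 0 < s * u"

lemma shadows_atI:
  assumes "trap x a b" "a \<le> c" "d \<le> b" "\<forall>u\<in>{c..d}. 0 < s * u" "u \<in> {c..d}"
  shows "shadows_at s x u"
  using assms unfolding shadows_at_def trap_def by (auto simp: abs_le_iff)

lemma line_shadowing_infinite:
  assumes steps: "\<And>n. noisy_step (s n) (X n) (X (Suc n))"
  shows "\<exists>w. \<forall>n. shadows_at (s n) (X n) ((\<alpha> ^^ n) w)"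
proof -
  have "\<bar>X 0\<bar> \<le> 1" using steps[of 0] by (simp add: noisy_step_def)
  from trapping_intervals[of X s, OF this] obtain A B C D where trap: "\<And>n. trap (X n) (A n) (B n)"
    and CD: "\<And>n. A n \<le> C n \<and> C n \<le> D n \<and> D n \<le> B n \<and> (\<forall>u\<in>{C n..D n}. 0 < s n * u) \<and>
      {A (Suc n)..B (Suc n)} \<subseteq> \<alpha> ` {C n..D n}"
    using steps by metis
  have "\<exists>w. \<forall>n. (\<alpha> ^^ n) w \<in> {C n..D n}"
  proof (rule covering_compact_orbit)
    fix n
    show "{C n..D n} \<noteq> {}" using CD[of n] by simp
    have "{C (Suc n)..D (Suc n)} \<subseteq> {A (Suc n)..B (Suc n)}" using CD[of "Suc n"] by auto
    then show "{C (Suc n)..D (Suc n)} \<subseteq> \<alpha> ` {C n..D n}" using CD[of n] by blast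
    have "\<bar>s n\<bar> = 1" using steps by (simp add: noisy_step_def)
    then consider "s n = 1" | "s n = -1" by (auto simp: abs_if split: if_splits)
    then have "{C n..D n} \<subseteq> {0<..1} \<or> {C n..D n} \<subseteq> {-1..<0}"
      using CD[of n] trap[of n] by cases (force simp: trap_def)+
    then show "continuous_on {C n..D n} \<alpha>"
      using lorenz_baseD(2,3)[OF base, THEN C1_on_imp_continuous_on] continuous_on_subset by blast
  qed simp
  then show ?thesis using shadows_atI[OF trap] CD by meson
qed

lemma line_shadowing_finite:
  assumes "\<bar>X 0\<bar> \<le> 1" and steps: "\<And>n. n < m \<Longrightarrow> noisy_step (s n) (X n) (X (Suc n))" and "X m = 0"
  shows "\<exists>w. (\<forall>n<m. shadows_at (s n) (X n) ((\<alpha> ^^ n) w)) \<and> (\<alpha> ^^ m) w = 0"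
proof -
  from trapping_intervals[of X s] assms(1) obtain A B C D where
    AB: "\<forall>n. ((\<forall>i<n. noisy_step (s i) (X i) (X (Suc i))) \<longrightarrow> trap (X n) (A n) (B n)) \<and>
    ((\<forall>i\<le>n. noisy_step (s i) (X i) (X (Suc i))) \<longrightarrow>
      A n \<le> C n \<and> C n \<le> D n \<and> D n \<le> B n \<and> (\<forall>u\<in>{C n..D n}. 0 < s n * u) \<and>
      {A (Suc n)..B (Suc n)} \<subseteq> \<alpha> ` {C n..D n})"
    by (elim meta_impE exE) simp_all
  have trap: "trap (X n) (A n) (B n)" if "n \<le> m" for n
    using AB steps that by simp
  have CD: "A n \<le> C n \<and> C n \<le> D n \<and> D n \<le> B n \<and> (\<forall>u\<in>{C n..D n}. 0 < s n * u) \<and>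
      {A (Suc n)..B (Suc n)} \<subseteq> \<alpha> ` {C n..D n}" if "n < m" for n
    using AB steps that by simp
  \<comment> \<open>the last set is the single target point on the discontinuity\<close>
  define K where "K n = (if n < m then {C n..D n} else {0})" for n
  have "\<exists>w. (\<forall>i\<le>m. (\<alpha> ^^ i) w \<in> K i) \<and> (\<alpha> ^^ m) w = 0"
  proof (rule pull_back_point)
    show "0 \<in> K m" by (simp add: K_def)
    fix i assume i: "i < m"
    have "K (Suc i) \<subseteq> {A (Suc i)..B (Suc i)}"
    proof (cases "Suc i < m")
      case True
      then show ?thesis using CD[of "Suc i"] by (auto simp: K_def)
    next
      case False
      with i have "m = Suc i" by simp
      then show ?thesis using trap_contains_0 trap[of m] assms(3) by (auto simp: K_def)
    qed
    then show "K (Suc i) \<subseteq> \<alpha> ` K i" using CD[OF i] i by (auto simp: K_def)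
  qed
  then obtain w where w: "\<And>i. i \<le> m \<Longrightarrow> (\<alpha> ^^ i) w \<in> K i" "(\<alpha> ^^ m) w = 0" by blast
  have "shadows_at (s n) (X n) ((\<alpha> ^^ n) w)" if "n < m" for n
    by (rule shadows_atI[OF trap[of n], of "C n" "D n"]) (use CD[OF that] w(1)[of n] that in \<open>auto simp: K_def\<close>)
  with w(2) show ?thesis by blast
qed

end

section \<open>Lifting to the square\<close>

text \<open>
  The bounds on the partial derivatives are integrated along a horizontal and a vertical segment;
  the horizontal one must not meet \<open>\<Gamma>\<close>, hence the restriction to one side.
\<close>

lemma fibre_map_lipschitz_on_side:
  fixes \<beta> :: "real \<Rightarrow> real \<Rightarrow> real"
  assumes C1: "C1_on L (S \<times> {-1..1})" and "convex S" and "S \<subseteq> {-1..1} - {0}"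
    and L_eq: "\<And>x y. x \<in> S \<Longrightarrow> y \<in> {-1..1} \<Longrightarrow> L (x, y) = (\<alpha> x, \<beta> x y)"
    and at_eq: "\<And>x. x \<in> S \<Longrightarrow> at x within {-1..1} - {0} = at x within S"
    and limpt: "\<And>x. x \<in> S \<Longrightarrow> at x within S \<noteq> bot"
    and dx: "\<And>x y. x \<in> S \<Longrightarrow> y \<in> {-1..1} \<Longrightarrow> \<bar>beta_dx \<beta> x y\<bar> \<le> k"
    and dy: "\<And>x y. x \<in> S \<Longrightarrow> y \<in> {-1..1} \<Longrightarrow> \<bar>beta_dy \<beta> x y\<bar> \<le> k"
    and in_S: "x \<in> S" "x' \<in> S" and in_T: "y \<in> {-1..1}" "y' \<in> {-1..1}"
  shows "\<bar>\<beta> x y - \<beta> x' y'\<bar> \<le> k * (\<bar>x - x'\<bar> + \<bar>y - y'\<bar>)"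
proof -
  have snd_eq: "snd (L (x, y)) = \<beta> x y" if "x \<in> S" "y \<in> {-1..1}" for x y
    using L_eq[OF that] by simp
  have snd1: "C1_on (\<lambda>p. snd (L p)) (S \<times> {-1..1})"
    by (rule C1_on_compose[OF C1 C1_on_bounded_linear[OF bounded_linear_snd] subset_UNIV])
  have pair: "C1_on (\<lambda>x. (x, y)) A" "C1_on (\<lambda>y. (x, y)) A" for x y :: real and A :: "real set"
  proof -
    have "C1_on (\<lambda>x. c) A" for c :: real
      unfolding C1_on_real_iff by (rule exI[of _ "\<lambda>_. 0"]) auto
    moreover have "C1_on (\<lambda>x. x) A"
      by (rule C1_on_bounded_linear[OF bounded_linear_ident])
    ultimately show "C1_on (\<lambda>x. (x, y)) A" "C1_on (\<lambda>y. (x, y)) A" by (auto intro: C1_on_Pair)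
  qed
  have x_part: "\<bar>\<beta> x y - \<beta> x' y\<bar> \<le> k * \<bar>x - x'\<bar>"
  proof -
    have "C1_on (\<lambda>x. snd (L (x, y))) S"
      by (rule C1_on_compose[OF pair(1) snd1]) (use in_T in auto)
    then have "C1_on (\<lambda>x. \<beta> x y) S"
      by (rule C1_on_cong) (use snd_eq in_T in auto)
    then obtain d where d: "\<And>x. x \<in> S \<Longrightarrow> ((\<lambda>x. \<beta> x y) has_real_derivative d x) (at x within S)"
      unfolding C1_on_real_iff by blast
    have "norm (d x) \<le> k" if "x \<in> S" for x
    proof -
      have "beta_dx \<beta> x y = d x"
        unfolding beta_dx_def at_eq[OF that]
        by (rule vector_derivative_within[OF limpt[OF that]])
          (use d[OF that] in \<open>simp add: has_real_derivative_iff_has_vector_derivative\<close>)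
      with dx[OF that in_T(1)] show ?thesis by simp
    qed
    from field_differentiable_bound[OF \<open>convex S\<close> d this in_S] show ?thesis by simp
  qed
  have y_part: "\<bar>\<beta> x' y - \<beta> x' y'\<bar> \<le> k * \<bar>y - y'\<bar>"
  proof -
    have "C1_on (\<lambda>y. snd (L (x', y))) {-1..1}"
      by (rule C1_on_compose[OF pair(2) snd1]) (use in_S in auto)
    then have "C1_on (\<lambda>y. \<beta> x' y) {-1..1}"
      by (rule C1_on_cong) (use snd_eq in_S in auto)
    then obtain d where d: "\<And>y. y \<in> {-1..1} \<Longrightarrow> ((\<lambda>y. \<beta> x' y) has_real_derivative d y) (at y within {-1..1})"
      unfolding C1_on_real_iff by blast
    have "norm (d y) \<le> k" if "y \<in> {-1..1}" for y
    proof -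
      have "beta_dy \<beta> x' y = d y"
        unfolding beta_dy_def
        by (rule vector_derivative_within_closed_interval)
          (use d[OF that] that in \<open>simp_all add: has_real_derivative_iff_has_vector_derivative\<close>)
      with dy[OF in_S(2) that] show ?thesis by simp
    qed
    from field_differentiable_bound[OF _ d this in_T] show ?thesis by simp
  qed
  from x_part y_part show ?thesis by (simp add: algebra_simps)
qed

lemma at_within_punctured_interval:
  fixes x :: real
  shows "x \<in> {0<..1} \<Longrightarrow> at x within {-1..1} - {0} = at x within {0<..1}"
    and "x \<in> {-1..<0} \<Longrightarrow> at x within {-1..1} - {0} = at x within {-1..<0}"
  by (rule at_within_nhd[of _ "{0<..}"]; auto) (rule at_within_nhd[of _ "{..<0}"]; auto)

lemma fibre_map_lipschitz:
  assumes "lorenz_map_with L \<alpha> \<beta>"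
    and bound: "\<forall>x y. (x, y) \<in> \<Sigma> - \<Gamma> \<longrightarrow> \<bar>beta_dx \<beta> x y\<bar> \<le> k \<and> \<bar>beta_dy \<beta> x y\<bar> \<le> k"
    and "x * x' > 0" "\<bar>x\<bar> \<le> 1" "\<bar>x'\<bar> \<le> 1" "\<bar>y\<bar> \<le> 1" "\<bar>y'\<bar> \<le> 1"
  shows "\<bar>\<beta> x y - \<beta> x' y'\<bar> \<le> k * (\<bar>x - x'\<bar> + \<bar>y - y'\<bar>)"
proof -
  note D = lorenz_map_withD[OF assms(1)]
  have C1: "C1_on L ({0<..1} \<times> {-1..1})" "C1_on L ({-1..<0} \<times> {-1..1})"
    using D(2,3) by (simp_all add: C1_diffeo_on_def)
  have *: "\<bar>beta_dx \<beta> x y\<bar> \<le> k" "\<bar>beta_dy \<beta> x y\<bar> \<le> k" if "x \<in> {-1..1} - {0}" "y \<in> {-1..1}" for x y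
  proof -
    have "(x, y) \<in> \<Sigma> - \<Gamma>" using that by (auto simp: \<Sigma>_def \<Gamma>_def)
    with bound show "\<bar>beta_dx \<beta> x y\<bar> \<le> k" "\<bar>beta_dy \<beta> x y\<bar> \<le> k" by simp_all
  qed
  have y: "y \<in> {-1..1}" "y' \<in> {-1..1}" using assms by (auto simp: abs_le_iff)
  from \<open>x * x' > 0\<close> consider "x > 0" "x' > 0" | "x < 0" "x' < 0"
    by (auto simp: zero_less_mult_iff)
  then show ?thesis
  proof cases
    case 1
    then have "x \<in> {0<..1}" "x' \<in> {0<..1}" using assms by auto
    from this y show ?thesis
      by (intro fibre_map_lipschitz_on_side[where S = "{0<..1}" and L = L and \<alpha> = \<alpha>])
        (auto intro!: C1 D(4) * simp: at_within_punctured_interval at_within_interval_neq_bot)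
  next
    case 2
    then have "x \<in> {-1..<0}" "x' \<in> {-1..<0}" using assms by auto
    from this y show ?thesis
      by (intro fibre_map_lipschitz_on_side[where S = "{-1..<0}" and L = L and \<alpha> = \<alpha>])
        (auto intro!: C1 D(4) * simp: at_within_punctured_interval at_within_interval_neq_bot)
  qed
qed

text \<open>
  The vertex plays the role of the missing image of \<open>\<Gamma>\<close>: letting one of the two points in the
  Lipschitz estimate tend to \<open>\<Gamma>\<close> replaces its image by the vertex. \<open>F\<close> is the filter of
  one-sided approach to \<open>0\<close>.
\<close>

lemma vertex_fibre_estimate:
  fixes M :: "real \<times> real \<Rightarrow> real \<times> real"
  assumes lim: "uniform_limit {-1..1} (\<lambda>x y. M (x, y)) (\<lambda>y. v) F" and "F \<noteq> bot"
    and ev: "\<forall>\<^sub>F t in F. t \<in> S" and "((\<lambda>t. t) \<longlongrightarrow> 0) F" and "(\<gamma> \<longlongrightarrow> c) F"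
    and M_eq: "\<And>x y. x \<in> S \<Longrightarrow> y \<in> {-1..1} \<Longrightarrow> M (x, y) = (\<gamma> x, \<beta> x y)"
    and lip: "\<And>x x' y. x \<in> S \<Longrightarrow> x' \<in> S \<Longrightarrow> y \<in> {-1..1} \<Longrightarrow> \<bar>\<beta> x y - \<beta> x' y\<bar> \<le> k * \<bar>x - x'\<bar>"
  shows "fst v = c" and "x \<in> S \<Longrightarrow> y \<in> {-1..1} \<Longrightarrow> \<bar>\<beta> x y - snd v\<bar> \<le> k * \<bar>x :: real\<bar>"
proof -
  have M: "((\<lambda>t. M (t, y)) \<longlongrightarrow> v) F" if "y \<in> {-1..1}" for y
    using tendsto_uniform_limitI[OF lim that] .
  have "((\<lambda>t. fst (M (t, 0))) \<longlongrightarrow> fst v) F"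
    by (intro tendsto_fst M) simp
  moreover have "\<forall>\<^sub>F t in F. fst (M (t, 0)) = \<gamma> t"
    using ev by eventually_elim (simp add: M_eq)
  ultimately have "(\<gamma> \<longlongrightarrow> fst v) F" using tendsto_cong by fastforce
  with \<open>(\<gamma> \<longlongrightarrow> c) F\<close> show "fst v = c" using tendsto_unique \<open>F \<noteq> bot\<close> by blast
  assume xy: "x \<in> S" "y \<in> {-1..1}"
  show "\<bar>\<beta> x y - snd v\<bar> \<le> k * \<bar>x\<bar>"
  proof (rule tendsto_le[OF \<open>F \<noteq> bot\<close>])
    show "((\<lambda>t. \<bar>\<beta> x y - snd (M (t, y))\<bar>) \<longlongrightarrow> \<bar>\<beta> x y - snd v\<bar>) F"
      by (intro tendsto_intros tendsto_snd M xy)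
    show "((\<lambda>t. k * \<bar>x - t\<bar>) \<longlongrightarrow> k * \<bar>x\<bar>) F"
      using assms(4) by (auto intro!: tendsto_eq_intros)
    show "\<forall>\<^sub>F t in F. \<bar>\<beta> x y - snd (M (t, y))\<bar> \<le> k * \<bar>x - t\<bar>"
      using ev by eventually_elim (use xy M_eq lip in simp)
  qed
qed

text \<open>
  The constant \<open>27 / 50\<close> lies above \<open>3 / (4 * sqrt 2)\<close> and satisfies \<open>27 / 50 * (1 + 2) < 2\<close>, which
  is what makes a fibre error of \<open>2 * e\<close> reproduce itself.
\<close>

locale lorenz_shift = shifted_line_dynamics +
  fixes L :: "real \<times> real \<Rightarrow> real \<times> real" and \<beta> :: "real \<Rightarrow> real \<Rightarrow> real"
  assumes lorenz: "lorenz_map_with L \<alpha> \<beta>"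
    and lipschitz: "\<And>x x' y y'. x * x' > 0 \<Longrightarrow> \<bar>x\<bar> \<le> 1 \<Longrightarrow> \<bar>x'\<bar> \<le> 1 \<Longrightarrow> \<bar>y\<bar> \<le> 1 \<Longrightarrow> \<bar>y'\<bar> \<le> 1 \<Longrightarrow>
      \<bar>\<beta> x y - \<beta> x' y'\<bar> \<le> 27 / 50 * (\<bar>x - x'\<bar> + \<bar>y - y'\<bar>)"
begin

text \<open>
  A pseudo-orbit step from \<open>p\<close> to \<open>q\<close> as seen from any point \<open>(u, y)\<close> on side \<open>s\<close>. This form
  makes sense whether or not \<open>p\<close> lies on \<open>\<Gamma>\<close>.
\<close>

definition fibre_step :: "real \<Rightarrow> real \<times> real \<Rightarrow> real \<times> real \<Rightarrow> bool" where
  "fibre_step s p q \<longleftrightarrow> (\<forall>u y. \<bar>u\<bar> \<le> 1 \<longrightarrow> 0 < s * u \<longrightarrow> \<bar>y\<bar> \<le> 1 \<longrightarrow>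
    \<bar>\<beta> u y - snd q\<bar> \<le> 27 / 50 * (\<bar>u - fst p\<bar> + \<bar>y - snd p\<bar>) + \<mu> / 100)"

lemma map_eq: "x \<noteq> 0 \<Longrightarrow> \<bar>x\<bar> \<le> 1 \<Longrightarrow> \<bar>y\<bar> \<le> 1 \<Longrightarrow> L (x, y) = (\<alpha> x, \<beta> x y)"
  using lorenz_map_withD(4)[OF lorenz, of x y] by (auto simp: abs_le_iff)

lemma fibre_range: "x \<noteq> 0 \<Longrightarrow> \<bar>x\<bar> \<le> 1 \<Longrightarrow> \<bar>y\<bar> \<le> 1 \<Longrightarrow> \<bar>\<beta> x y\<bar> \<le> 1"
  using lorenz_map_withD(6)[OF lorenz, of x y] by (auto simp: abs_le_iff)

lemma vertex_pos_estimate: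
  assumes "vertex_pos (shifted L \<mu>) v"
  shows "fst v = -1" and "0 < u \<Longrightarrow> u \<le> 1 \<Longrightarrow> \<bar>y\<bar> \<le> 1 \<Longrightarrow> \<bar>\<beta> u y - snd v\<bar> \<le> 27 / 50 * \<bar>u\<bar>"
proof -
  have ev: "\<forall>\<^sub>F t in at_right 0. t \<in> {0<..1::real}"
    using eventually_at_right_real[of 0 1] by (auto elim: eventually_mono)
  have lim: "((\<lambda>x. \<alpha> x - \<mu> * x) \<longlongrightarrow> -1) (at_right 0)"
    using lorenz_baseD(5)[OF base] by (auto intro!: tendsto_eq_intros)
  have eq: "shifted L \<mu> (x, y) = (\<alpha> x - \<mu> * x, \<beta> x y)" if "x \<in> {0<..1}" "y \<in> {-1..1}" for x y
    using map_eq[of x y] that by (simp add: shifted_def abs_le_iff)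
  have lip: "\<bar>\<beta> x y - \<beta> x' y\<bar> \<le> 27 / 50 * \<bar>x - x'\<bar>"
    if "x \<in> {0<..1}" "x' \<in> {0<..1}" "y \<in> {-1..1}" for x x' y
    using lipschitz[of x x' y y] that by (auto simp: abs_le_iff)
  note * = vertex_fibre_estimate[OF assms[unfolded vertex_pos_def] _ ev tendsto_ident_at lim eq lip]
  show "fst v = -1" by (rule *(1)) auto
  show "0 < u \<Longrightarrow> u \<le> 1 \<Longrightarrow> \<bar>y\<bar> \<le> 1 \<Longrightarrow> \<bar>\<beta> u y - snd v\<bar> \<le> 27 / 50 * \<bar>u\<bar>"
    by (rule *(2)) (auto simp: abs_le_iff)
qed

lemma vertex_neg_estimate:
  assumes "vertex_neg (shifted L \<mu>) v"
  shows "fst v = 1" and "u < 0 \<Longrightarrow> -1 \<le> u \<Longrightarrow> \<bar>y\<bar> \<le> 1 \<Longrightarrow> \<bar>\<beta> u y - snd v\<bar> \<le> 27 / 50 * \<bar>u\<bar>"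
proof -
  have ev: "\<forall>\<^sub>F t in at_left 0. t \<in> {-1..<0::real}"
    using eventually_at_left_real[of "-1" 0] by (auto elim: eventually_mono)
  have lim: "((\<lambda>x. \<alpha> x - \<mu> * x) \<longlongrightarrow> 1) (at_left 0)"
    using lorenz_base_limit_left[OF base] by (auto intro!: tendsto_eq_intros)
  have eq: "shifted L \<mu> (x, y) = (\<alpha> x - \<mu> * x, \<beta> x y)" if "x \<in> {-1..<0}" "y \<in> {-1..1}" for x y
    using map_eq[of x y] that by (simp add: shifted_def abs_le_iff)
  have lip: "\<bar>\<beta> x y - \<beta> x' y\<bar> \<le> 27 / 50 * \<bar>x - x'\<bar>"
    if "x \<in> {-1..<0}" "x' \<in> {-1..<0}" "y \<in> {-1..1}" for x x' y
    using lipschitz[of x x' y y] that by (auto simp: abs_le_iff mult_neg_neg)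
  note * = vertex_fibre_estimate[OF assms[unfolded vertex_neg_def] _ ev tendsto_ident_at lim eq lip]
  show "fst v = 1" by (rule *(1)) auto
  show "u < 0 \<Longrightarrow> -1 \<le> u \<Longrightarrow> \<bar>y\<bar> \<le> 1 \<Longrightarrow> \<bar>\<beta> u y - snd v\<bar> \<le> 27 / 50 * \<bar>u\<bar>"
    by (rule *(2)) (auto simp: abs_le_iff)
qed

lemma pseudo_step_decompose:
  assumes "pseudo_step (\<mu> / 100) (shifted L \<mu>) p q" and "p \<in> \<Sigma>" and "q \<in> \<Sigma>"
  shows "\<exists>s. noisy_step s (fst p) (fst q) \<and> fibre_step s p q"
proof -
  obtain x y x' y' where pq [simp]: "p = (x, y)" "q = (x', y')" by (cases p, cases q)
  have range: "\<bar>x\<bar> \<le> 1" "\<bar>y\<bar> \<le> 1" "\<bar>x'\<bar> \<le> 1" "\<bar>y'\<bar> \<le> 1" using assms(2,3) by (auto simp: \<Sigma>_def)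
  show ?thesis
  proof (cases "x = 0")
    case True
    then have "p \<in> \<Gamma>" using range by (simp add: \<Gamma>_def)
    then obtain v where v: "vertex_pos (shifted L \<mu>) v \<or> vertex_neg (shifted L \<mu>) v"
      and close: "dist v q < \<mu> / 100"
      using assms(1) by (auto simp: pseudo_step_def)
    have close_fst: "\<bar>fst v - x'\<bar> \<le> \<mu> / 100" and close_snd: "\<bar>snd v - y'\<bar> \<le> \<mu> / 100"
      using dist_fst_le[of v q] dist_snd_le[of v q] close by (simp_all add: dist_real_def)
    have fibre: "fibre_step s p q"
      if "\<And>u y. \<bar>u\<bar> \<le> 1 \<Longrightarrow> 0 < s * u \<Longrightarrow> \<bar>y\<bar> \<le> 1 \<Longrightarrow> \<bar>\<beta> u y - snd v\<bar> \<le> 27 / 50 * \<bar>u\<bar>" for s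
      unfolding fibre_step_def
    proof (intro allI impI)
      fix u w :: real assume "\<bar>u\<bar> \<le> 1" "0 < s * u" "\<bar>w\<bar> \<le> 1"
      from that[OF this] have "\<bar>\<beta> u w - snd v\<bar> \<le> 27 / 50 * \<bar>u\<bar>" .
      moreover have "\<bar>u - fst p\<bar> = \<bar>u\<bar>" "0 \<le> \<bar>w - snd p\<bar>" "snd q = y'" using True by simp_all
      ultimately show "\<bar>\<beta> u w - snd q\<bar> \<le> 27 / 50 * (\<bar>u - fst p\<bar> + \<bar>w - snd p\<bar>) + \<mu> / 100"
        using close_snd by argo
    qed
    from v show ?thesis
    proof
      assume v: "vertex_pos (shifted L \<mu>) v"
      have "noisy_step 1 x x'"
        using vertex_pos_estimate(1)[OF v] close_fst range True by (simp add: noisy_step_def)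
      moreover have "fibre_step 1 p q"
        by (rule fibre, rule vertex_pos_estimate(2)[OF v]) auto
      ultimately show ?thesis by auto
    next
      assume v: "vertex_neg (shifted L \<mu>) v"
      have "noisy_step (-1) x x'"
        using vertex_neg_estimate(1)[OF v] close_fst range True by (simp add: noisy_step_def)
      moreover have "fibre_step (-1) p q"
        by (rule fibre, rule vertex_neg_estimate(2)[OF v]) auto
      ultimately show ?thesis by auto
    qed
  next
    case False
    then have "p \<notin> \<Gamma>" by (simp add: \<Gamma>_def)
    then have "norm (shifted L \<mu> p - q) \<le> \<mu> / 100"
      using assms(1) by (simp add: pseudo_step_def)
    moreover have "shifted L \<mu> p - q = (\<alpha> x - \<mu> * x - x', \<beta> x y - y')"
      using map_eq[of x y] False range by (simp add: shifted_def)
    ultimately have close: "\<bar>\<alpha> x - \<mu> * x - x'\<bar> \<le> \<mu> / 100" "\<bar>\<beta> x y - y'\<bar> \<le> \<mu> / 100"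
      using norm_fst_le[of "\<alpha> x - \<mu> * x - x'" "\<beta> x y - y'"]
        norm_snd_le[of "\<beta> x y - y'" "\<alpha> x - \<mu> * x - x'"] by simp_all
    have "noisy_step (sgn x) x x'"
      using False range close by (auto simp: noisy_step_def sgn_if)
    moreover have "fibre_step (sgn x) p q"
      unfolding fibre_step_def
    proof (intro allI impI)
      fix u w :: real assume u: "\<bar>u\<bar> \<le> 1" "0 < sgn x * u" "\<bar>w\<bar> \<le> 1"
      then have "u * x > 0"
        using False by (auto simp: sgn_if zero_less_mult_iff split: if_splits)
      with lipschitz[of u x w y] u range
      have "\<bar>\<beta> u w - \<beta> x y\<bar> \<le> 27 / 50 * (\<bar>u - x\<bar> + \<bar>w - y\<bar>)" by simp
      with close(2) show "\<bar>\<beta> u w - snd q\<bar> \<le> 27 / 50 * (\<bar>u - fst p\<bar> + \<bar>w - snd p\<bar>) + \<mu> / 100"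
        unfolding pq fst_conv snd_conv by argo
    qed
    ultimately show ?thesis by auto
  qed
qed

text \<open>
  The fibre maps contract, so a shadow of the first coordinates on the prescribed sides can be started
  at height \<open>snd (X 0)\<close>, and its second coordinates then stay close without further choice.
\<close>

lemma lift_line_shadow:
  assumes "\<bar>snd (X 0)\<bar> \<le> 1"
    and "\<And>i. i < n \<Longrightarrow> shadows_at (s i) (fst (X i)) ((\<alpha> ^^ i) w)"
    and "\<And>i. i < n \<Longrightarrow> fibre_step (s i) (X i) (X (Suc i))"
  shows "\<exists>y. (L ^^ n) (w, snd (X 0)) = ((\<alpha> ^^ n) w, y) \<and> \<bar>y\<bar> \<le> 1 \<and> \<bar>y - snd (X n)\<bar> \<le> 2 * e"
  using assms(2,3)
proof (induction n)
  case 0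
  then show ?case using assms(1) \<mu> by simp
next
  case (Suc n)
  from Suc.IH[OF Suc.prems] obtain y where
    y: "(L ^^ n) (w, snd (X 0)) = ((\<alpha> ^^ n) w, y)" "\<bar>y\<bar> \<le> 1" "\<bar>y - snd (X n)\<bar> \<le> 2 * e"
    by auto
  define u where "u = (\<alpha> ^^ n) w"
  have u: "\<bar>u - fst (X n)\<bar> \<le> e" "\<bar>u\<bar> \<le> 1" "0 < s n * u"
    using Suc.prems(1)[of n] by (simp_all add: shadows_at_def u_def)
  then have "u \<noteq> 0" by auto
  have "\<bar>\<beta> u y - snd (X (Suc n))\<bar> \<le> 27 / 50 * (\<bar>u - fst (X n)\<bar> + \<bar>y - snd (X n)\<bar>) + \<mu> / 100"
    using Suc.prems(2)[of n] u y(2) unfolding fibre_step_def by simp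
  then have "\<bar>\<beta> u y - snd (X (Suc n))\<bar> \<le> 2 * e"
    using u(1) y(3) \<mu>(1,4) by argo
  moreover have "(L ^^ Suc n) (w, snd (X 0)) = ((\<alpha> ^^ Suc n) w, \<beta> u y)"
    using y(1,2) map_eq[OF \<open>u \<noteq> 0\<close> u(2) y(2)] by (simp add: u_def)
  ultimately show ?case using fibre_range[OF \<open>u \<noteq> 0\<close> u(2) y(2)] by auto
qed

lemma norm_Pair_diff_le:
  fixes p :: "real \<times> real"
  assumes "\<bar>a - fst p\<bar> \<le> e" and "\<bar>b - snd p\<bar> \<le> 2 * e"
  shows "norm ((a, b) - p) \<le> 3 * e"
proof -
  have "norm ((a, b) - p) \<le> \<bar>a - fst p\<bar> + \<bar>b - snd p\<bar>"
    by (cases p) (simp add: norm_prod_def sqrt_sum_squares_le_sum_abs)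
  with assms show ?thesis by linarith
qed

lemma shadowing_infinite:
  assumes "infinite_pseudo_orbit (\<mu> / 100) (shifted L \<mu>) X"
  shows "\<exists>z\<in>\<Sigma>. (\<Union>n. {(L ^^ n) z}) \<inter> \<Gamma> = {} \<and> (\<forall>n. norm ((L ^^ n) z - X n) \<le> 3 * e)"
proof -
  have X: "\<And>n. X n \<in> \<Sigma>" and ps: "\<And>n. pseudo_step (\<mu> / 100) (shifted L \<mu>) (X n) (X (Suc n))"
    using assms by (auto simp: infinite_pseudo_orbit_def)
  have "\<forall>n. \<exists>s. noisy_step s (fst (X n)) (fst (X (Suc n))) \<and> fibre_step s (X n) (X (Suc n))"
    using pseudo_step_decompose[OF ps X X] by blast
  then obtain s where s: "\<And>n. noisy_step (s n) (fst (X n)) (fst (X (Suc n)))"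
    "\<And>n. fibre_step (s n) (X n) (X (Suc n))" by metis
  obtain w where w: "\<And>n. shadows_at (s n) (fst (X n)) ((\<alpha> ^^ n) w)"
    using line_shadowing_infinite[of s "\<lambda>n. fst (X n)"] s(1) by blast
  have y0: "\<bar>snd (X 0)\<bar> \<le> 1" using X[of 0] by (auto simp: \<Sigma>_def)
  define z where "z = (w, snd (X 0))"
  have orbit: "\<exists>y. (L ^^ n) z = ((\<alpha> ^^ n) w, y) \<and> \<bar>y\<bar> \<le> 1 \<and> \<bar>y - snd (X n)\<bar> \<le> 2 * e" for n
    unfolding z_def by (rule lift_line_shadow[of X _ s, OF y0 w s(2)])
  have "(\<alpha> ^^ n) w \<noteq> 0" for n using w[of n] by (auto simp: shadows_at_def)
  then have "(L ^^ n) z \<notin> \<Gamma>" for n using orbit[of n] by (auto simp: \<Gamma>_def)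
  moreover have "norm ((L ^^ n) z - X n) \<le> 3 * e" for n
    using orbit[of n] w[of n] norm_Pair_diff_le unfolding shadows_at_def by metis
  moreover have "z \<in> \<Sigma>" using w[of 0] y0 by (simp add: z_def \<Sigma>_def shadows_at_def)
  ultimately show ?thesis by blast
qed

lemma shadowing_finite:
  assumes "finite_pseudo_orbit (\<mu> / 100) (shifted L \<mu>) m X" and "X m \<in> \<Gamma>"
  shows "\<exists>z\<in>\<Sigma>. (\<Union>n<m. {(L ^^ n) z}) \<inter> \<Gamma> = {} \<and> (L ^^ m) z \<in> \<Gamma> \<and>
    (\<forall>n\<le>m. norm ((L ^^ n) z - X n) \<le> 3 * e)"
proof -
  have X: "\<And>n. n \<le> m \<Longrightarrow> X n \<in> \<Sigma>"
    and ps: "\<And>n. n < m \<Longrightarrow> pseudo_step (\<mu> / 100) (shifted L \<mu>) (X n) (X (Suc n))"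
    using assms by (auto simp: finite_pseudo_orbit_def)
  have "\<forall>n. \<exists>s. n < m \<longrightarrow> noisy_step s (fst (X n)) (fst (X (Suc n))) \<and> fibre_step s (X n) (X (Suc n))"
    using pseudo_step_decompose[OF ps X X] by (meson Suc_leI less_imp_le)
  then obtain s where s: "\<And>n. n < m \<Longrightarrow> noisy_step (s n) (fst (X n)) (fst (X (Suc n)))"
    "\<And>n. n < m \<Longrightarrow> fibre_step (s n) (X n) (X (Suc n))" by metis
  have x0: "\<bar>fst (X 0)\<bar> \<le> 1" and y0: "\<bar>snd (X 0)\<bar> \<le> 1" using X[of 0] by (auto simp: \<Sigma>_def)
  have Xm: "fst (X m) = 0" using assms(2) by (auto simp: \<Gamma>_def)
  obtain w where w: "\<And>n. n < m \<Longrightarrow> shadows_at (s n) (fst (X n)) ((\<alpha> ^^ n) w)" and wm: "(\<alpha> ^^ m) w = 0"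
    using line_shadowing_finite[of "\<lambda>n. fst (X n)" m s] s(1) x0 Xm by blast
  define z where "z = (w, snd (X 0))"
  have orbit: "\<exists>y. (L ^^ n) z = ((\<alpha> ^^ n) w, y) \<and> \<bar>y\<bar> \<le> 1 \<and> \<bar>y - snd (X n)\<bar> \<le> 2 * e" if "n \<le> m" for n
    unfolding z_def by (rule lift_line_shadow[of X _ s, OF y0]) (use w s(2) that in auto)
  have ne: "(\<alpha> ^^ n) w \<noteq> 0" if "n < m" for n using w[OF that] by (auto simp: shadows_at_def)
  have "(L ^^ n) z \<notin> \<Gamma>" if "n < m" for n using orbit[of n] ne[OF that] that by (auto simp: \<Gamma>_def)
  moreover have "(L ^^ m) z \<in> \<Gamma>" using orbit[of m] wm by (auto simp: \<Gamma>_def)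
  moreover have "norm ((L ^^ n) z - X n) \<le> 3 * e" if "n \<le> m" for n
  proof -
    have "\<bar>(\<alpha> ^^ n) w - fst (X n)\<bar> \<le> e"
      using w[of n] that wm Xm \<mu>(1,4) by (cases "n = m") (auto simp: shadows_at_def)
    with orbit[OF that] show ?thesis using norm_Pair_diff_le by metis
  qed
  moreover have "z \<in> \<Sigma>"
    using w[of 0] wm y0 by (cases "m = 0") (auto simp: z_def \<Sigma>_def shadows_at_def)
  ultimately show ?thesis by blast
qed

end

section \<open>Parameter-shifted shadowing\<close>

theorem theoremA:
  fixes L :: "real \<times> real \<Rightarrow> real \<times> real"
    and \<alpha> :: "real \<Rightarrow> real"
    and \<beta> :: "real \<Rightarrow> real \<Rightarrow> real"
  assumes "lorenz_map_with L \<alpha> \<beta>"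
    and "\<forall>x y. (x, y) \<in> \<Sigma> - \<Gamma> \<longrightarrow>
           \<bar>beta_dx \<beta> x y\<bar> < 3 / (4 * sqrt 2) \<and> \<bar>beta_dy \<beta> x y\<bar> < 3 / (4 * sqrt 2)"
    and "0.8 < \<alpha> (\<alpha> 1)" and "\<alpha> (\<alpha> 1) < \<alpha> 1" and "\<alpha> 1 < 1"
    and "\<forall>x. 0.8 < x \<and> x \<le> 1 \<longrightarrow> alpha_deriv \<alpha> x < 2"
  shows "\<exists>\<mu>0. 0 < \<mu>0 \<and> \<mu>0 < 1 \<and>
    (\<forall>\<mu>\<in>{0..\<mu>0}. lorenz_map (shifted L \<mu>)) \<and>
    (\<forall>\<epsilon>>0. \<exists>\<delta>>0. \<exists>\<mu>\<in>{0..\<mu>0}. \<mu> > 0 \<and>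
      (\<forall>X. infinite_pseudo_orbit \<delta> (shifted L \<mu>) X \<longrightarrow>
        (\<exists>z\<in>\<Sigma>. (\<Union>n. {(L ^^ n) z}) \<inter> \<Gamma> = {} \<and>
               (\<forall>n. norm ((L ^^ n) z - X n) \<le> \<epsilon>))) \<and>
      (\<forall>m X. finite_pseudo_orbit \<delta> (shifted L \<mu>) m X \<and> X m \<in> \<Gamma> \<longrightarrow>
        (\<exists>z\<in>\<Sigma>. (\<Union>n<m. {(L ^^ n) z}) \<inter> \<Gamma> = {} \<and> (L ^^ m) z \<in> \<Gamma> \<and>
               (\<forall>n\<le>m. norm ((L ^^ n) z - X n) \<le> \<epsilon>))))"
proof -
  obtain \<mu>0 where \<mu>0: "0 < \<mu>0" "\<mu>0 < 1" "\<And>\<mu>. \<mu> \<in> {0..\<mu>0} \<Longrightarrow> lorenz_map (shifted L \<mu>)"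
    using lorenz_map_shifted[OF assms(1)] by metis
  have base: "lorenz_base \<alpha>" using lorenz_map_withD(5)[OF assms(1)] .
  have "3 / (4 * sqrt 2) \<le> 27 / 50"
    using sqrt_2_bounds by (simp add: field_simps)
  then have "\<forall>x y. (x, y) \<in> \<Sigma> - \<Gamma> \<longrightarrow> \<bar>beta_dx \<beta> x y\<bar> \<le> 27 / 50 \<and> \<bar>beta_dy \<beta> x y\<bar> \<le> 27 / 50"
    using assms(2) by (meson less_imp_le order_trans)
  note lip = fibre_map_lipschitz[OF assms(1) this]
  have shadow: "\<exists>\<delta>>0. \<exists>\<mu>\<in>{0..\<mu>0}. \<mu> > 0 \<and>
      (\<forall>X. infinite_pseudo_orbit \<delta> (shifted L \<mu>) X \<longrightarrow>
        (\<exists>z\<in>\<Sigma>. (\<Union>n. {(L ^^ n) z}) \<inter> \<Gamma> = {} \<and>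
               (\<forall>n. norm ((L ^^ n) z - X n) \<le> \<epsilon>))) \<and>
      (\<forall>m X. finite_pseudo_orbit \<delta> (shifted L \<mu>) m X \<and> X m \<in> \<Gamma> \<longrightarrow>
        (\<exists>z\<in>\<Sigma>. (\<Union>n<m. {(L ^^ n) z}) \<inter> \<Gamma> = {} \<and> (L ^^ m) z \<in> \<Gamma> \<and>
               (\<forall>n\<le>m. norm ((L ^^ n) z - X n) \<le> \<epsilon>)))" if "\<epsilon> > 0" for \<epsilon>
  proof -
    \<comment> \<open>the third bound keeps the pseudo-orbit above 4 / 5 throughout a recovery, the last one 3 * \<mu> \<le> \<epsilon> / 3\<close>
    define \<mu> where "\<mu> = Min {\<mu>0, 1 / 20, (\<alpha> (\<alpha> 1) - 4 / 5) / 4, \<epsilon> / 9}"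
    have le: "\<mu> \<le> r" if "r \<in> {\<mu>0, 1 / 20, (\<alpha> (\<alpha> 1) - 4 / 5) / 4, \<epsilon> / 9}" for r
      unfolding \<mu>_def using that by (intro Min_le) auto
    have "0 < \<mu>"
      using \<mu>0 assms(3) that by (simp add: \<mu>_def)
    then have small: "0 < \<mu>" "\<mu> \<le> \<mu>0" "\<mu> \<le> 1 / 20" "\<mu> \<le> (\<alpha> (\<alpha> 1) - 4 / 5) / 4" "\<mu> \<le> \<epsilon> / 9"
      by (simp_all only: le insert_iff simp_thms)
    have "\<forall>\<^sub>F t in at_right 0. \<alpha> t < -1 + \<mu> / 100"
      using small(1) by (intro order_tendstoD(2)[OF lorenz_baseD(5)[OF base]]) simp
    moreover have "\<forall>\<^sub>F t in at_right 0. t \<in> {0<..<\<mu>}"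
      using small(1) by (rule eventually_at_right_real)
    ultimately have "\<forall>\<^sub>F t in at_right 0. \<alpha> t < -1 + \<mu> / 100 \<and> t \<in> {0<..<\<mu>}"
      by eventually_elim simp
    then obtain \<tau> where \<tau>: "\<alpha> \<tau> < -1 + \<mu> / 100" "0 < \<tau>" "\<tau> < \<mu>"
      using eventually_happens[of _ "at_right (0::real)"] by auto
    interpret lorenz_shift \<alpha> \<mu> "\<epsilon> / 3" \<tau> L \<beta>
      by unfold_locales (use base assms small \<tau> lip in auto)
    from shadowing_infinite shadowing_finite small show ?thesis
      by (intro exI[of _ "\<mu> / 100"] conjI bexI[of _ \<mu>]) auto
  qed
  with \<mu>0 show ?thesis by (intro exI[of _ \<mu>0]) blast
qed

end
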